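(* Let $q$ be an odd prime power with $q\equiv0,\pm1\pmod5$, let $b\in\mathbb{F}_q$ with $b^2+b=1$, and let $g(x)=x^q+x^{q^3}+bx^{q^5}$. The code $\mathcal{C}_g$ is an $\mathbb{F}_q$-linear MRD-code with parameters $(6,6,q;5)$ and middle nucleus isomorphic to $\mathbb{F}_{q^6}$, and it is not equivalent to any of the codes $\mathcal{C}_f$ with $f(x)=x^{q^s}$ ($\gcd(s,6)=1$), $f(x)=\delta x^{q^s}+x^{q^{6-s}}$ ($\gcd(s,6)=1$, $\mathrm{N}_{q^6/q}(\delta)\notin\{0,1\}$), or $f(x)=\delta x^{q^s}+x^{q^{s+3}}$ ($\gcd(s,3)=1$, $\mathrm{N}_{q^6/q^3}(\delta)\notin\{0,1\}$, with $\delta,q$ such that $\{(x,f(x)):x\in\mathbb{F}_{q^6}\}$ is maximum scattered), these being the previously known $\mathbb{F}_q$-linear MRD-codes with parameters $(6,6,q;5)$ and middle nucleus isomorphic to $\mathbb{F}_{q^6}$.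
   Context: $\mathbb{F}_q^{m\times n}$ carries the rank distance $d(A,B)=\mathrm{rk}(A-B)$; a code $\mathcal{C}\subseteq\mathbb{F}_q^{m\times n}$ with minimum distance $d$ is MRD if $|\mathcal{C}|=q^{\max\{m,n\}(\min\{m,n\}-d+1)}$; an $\mathbb{F}_q$-linear code (an $\mathbb{F}_q$-subspace) with minimum distance $d$ has parameters $(m,n,q;d)$. Fixing an $\mathbb{F}_q$-basis of $\mathbb{F}_{q^n}$ identifies $\mathrm{End}_{\mathbb{F}_q}(\mathbb{F}_{q^n})$ with $\mathbb{F}_q^{n\times n}$ (each map sent to its matrix). For a $q$-polynomial $f$ over $\mathbb{F}_{q^n}$, $\mathcal{C}_f=\{x\mapsto af(x)+bx : a,b\in\mathbb{F}_{q^n}\}$, viewed as a set of $n\times n$ matrices over $\mathbb{F}_q$. The middle nucleus (left idealiser) of $\mathcal{C}\subseteq\mathrm{End}_{\mathbb{F}_q}(\mathbb{F}_{q^n})$ is $\{\varphi\in\mathrm{End}_{\mathbb{F}_q}(\mathbb{F}_{q^n}) : \varphi\circ c\in\mathcal{C}\ \text{for all } c\in\mathcal{C}\}$. Codes $\mathcal{C},\mathcal{C}'\subseteq\mathbb{F}_q^{m\times m}$ are equivalent if there are invertible $A,B\in\mathbb{F}_q^{m\times m}$ and a field automorphism $\sigma$ with $\{AC^\sigma B : C\in\mathcal{C}\}=\mathcal{C}'$ or $\{A(C^{T})^\sigma B : C\in\mathcal{C}\}=\mathcal{C}'$. An $\mathbb{F}_q$-subspace $U\le\mathbb{F}_{q^n}^2$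 of dimension $n$ is maximum scattered if $|\{\langle u\rangle_{\mathbb{F}_{q^n}}:u\in U\setminus\{0\}\}|=(q^n-1)/(q-1)$. $\mathrm{N}_{q^6/q}(\delta)=\delta^{1+q+\dots+q^5}$, $\mathrm{N}_{q^6/q^3}(\delta)=\delta^{1+q^3}$. *)

theory Defs
  imports "HOL-Analysis.Analysis" "HOL-Algebra.Algebraic_Closure_Type"
begin

text \<open>
  The field with $q$ elements is a type \<open>'k\<close>, its extension of degree $n$ is a type \<open>'l\<close>,
  and the inclusion of the former in the latter is a ring homomorphism \<open>\<iota>\<close>.
\<close>

definition field_hom :: "('a::field \<Rightarrow> 'b::field) \<Rightarrow> bool" where
  "field_hom h \<longleftrightarrow> h \<in> ring_hom ring_of_type_algebra ring_of_type_algebra"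

definition field_aut :: "('a::field \<Rightarrow> 'a) \<Rightarrow> bool" where
  "field_aut h \<longleftrightarrow> h \<in> ring_iso ring_of_type_algebra ring_of_type_algebra"

definition ext_scale :: "('k::field \<Rightarrow> 'l::field) \<Rightarrow> 'k \<Rightarrow> 'l \<Rightarrow> 'l" where
  "ext_scale \<iota> c x = \<iota> c * x"

definition pair_scale :: "'l::field \<Rightarrow> 'l \<times> 'l \<Rightarrow> 'l \<times> 'l" where
  "pair_scale c u = (c * fst u, c * snd u)"

definition matrix_scale :: "'k::field \<Rightarrow> 'k^'n^'m \<Rightarrow> 'k^'n^'m" where
  "matrix_scale c A = map_matrix ((*) c) A"


subsection \<open>Rank-metric codes\<close>

definition rank_distance :: "'k::field^'n^'m \<Rightarrow> 'k^'n^'m \<Rightarrow> nat" where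
  "rank_distance A B = rank (A - B)"

definition min_distance :: "('k::{field,finite}^'n^'m) set \<Rightarrow> nat" where
  "min_distance C = Min {rank_distance A B | A B. A \<in> C \<and> B \<in> C \<and> A \<noteq> B}"

definition linear_code :: "('k::{field,finite}^'n^'m) set \<Rightarrow> bool" where
  "linear_code C \<longleftrightarrow> module.subspace matrix_scale C"

definition is_MRD :: "('k::{field,finite}^'n^'m) set \<Rightarrow> bool" where
  "is_MRD C \<longleftrightarrow>
     card C = CARD('k) ^ (max CARD('m) CARD('n) * (min CARD('m) CARD('n) - min_distance C + 1))"

definition equivalent_codes ::
    "('k::{field,finite}^'m^'m) set \<Rightarrow> ('k^'m^'m) set \<Rightarrow> bool" where
  "equivalent_codes C C' \<longleftrightarrow>
     (\<exists>A B \<sigma>. invertible A \<and> invertible B \<and> field_aut \<sigma> \<and>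
        ({A ** map_matrix \<sigma> M ** B | M. M \<in> C} = C' \<or>
         {A ** map_matrix \<sigma> (transpose M) ** B | M. M \<in> C} = C'))"


subsection \<open>Endomorphisms of the extension and their matrices\<close>

definition is_basis :: "('k::field \<Rightarrow> 'l::field) \<Rightarrow> ('n \<Rightarrow> 'l) \<Rightarrow> bool" where
  "is_basis \<iota> \<beta> \<longleftrightarrow> inj \<beta> \<and> \<not> module.dependent (ext_scale \<iota>) (range \<beta>) \<and>
     module.span (ext_scale \<iota>) (range \<beta>) = UNIV"

text \<open>Column $j$ holds the coordinates of the image of the $j$-th basis element.\<close>

definition endo_matrix ::
    "('k::field \<Rightarrow> 'l::field) \<Rightarrow> ('n::finite \<Rightarrow> 'l) \<Rightarrow> ('l \<Rightarrow> 'l) \<Rightarrow> 'k^'n^'n" where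
  "endo_matrix \<iota> \<beta> f =
     (\<chi> i j. module.representation (ext_scale \<iota>) (range \<beta>) (f (\<beta> j)) (\<beta> i))"

definition endo_code :: "('l::field \<Rightarrow> 'l) \<Rightarrow> ('l \<Rightarrow> 'l) set" where
  "endo_code f = {\<lambda>x. a * f x + b * x | a b. True}"

definition matrix_code ::
    "('k::field \<Rightarrow> 'l::field) \<Rightarrow> ('n::finite \<Rightarrow> 'l) \<Rightarrow> ('l \<Rightarrow> 'l) \<Rightarrow> ('k^'n^'n) set" where
  "matrix_code \<iota> \<beta> f = endo_matrix \<iota> \<beta> ` endo_code f"

definition middle_nucleus ::
    "('k::field \<Rightarrow> 'l::field) \<Rightarrow> ('l \<Rightarrow> 'l) set \<Rightarrow> ('l \<Rightarrow> 'l) set" where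
  "middle_nucleus \<iota> C =
     {\<phi>. Vector_Spaces.linear (ext_scale \<iota>) (ext_scale \<iota>) \<phi> \<and> (\<forall>c\<in>C. \<phi> \<circ> c \<in> C)}"

definition middle_nucleus_ring ::
    "('k::field \<Rightarrow> 'l::field) \<Rightarrow> ('l \<Rightarrow> 'l) set \<Rightarrow> ('l \<Rightarrow> 'l) ring" where
  "middle_nucleus_ring \<iota> C =
     \<lparr> carrier = middle_nucleus \<iota> C, monoid.mult = (\<circ>), one = id,
       ring.zero = (\<lambda>_. 0), add = (\<lambda>\<phi> \<psi> x. \<phi> x + \<psi> x) \<rparr>"

text \<open>The code of \<open>f\<close> is a linear MRD code with parameters $(n,n,q;d)$, and its middle nucleus
  is isomorphic to the extension field \<open>'l\<close>.\<close>

definition linear_MRD_with_field_nucleus ::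
    "('k::{field,finite} \<Rightarrow> 'l::field) \<Rightarrow> ('n::finite \<Rightarrow> 'l) \<Rightarrow> nat \<Rightarrow> ('l \<Rightarrow> 'l) \<Rightarrow> bool" where
  "linear_MRD_with_field_nucleus \<iota> \<beta> d f \<longleftrightarrow>
     linear_code (matrix_code \<iota> \<beta> f) \<and>
     min_distance (matrix_code \<iota> \<beta> f) = d \<and>
     is_MRD (matrix_code \<iota> \<beta> f) \<and>
     middle_nucleus_ring \<iota> (endo_code f) \<simeq> (ring_of_type_algebra :: 'l ring)"


subsection \<open>Maximum scattered subspaces\<close>

definition ext_degree :: "('k::field \<Rightarrow> 'l::field) \<Rightarrow> nat" where
  "ext_degree \<iota> = vector_space.dim (ext_scale \<iota>) (UNIV :: 'l set)"

definition maximum_scattered ::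
    "('k::{field,finite} \<Rightarrow> 'l::{field,finite}) \<Rightarrow> ('l \<times> 'l) set \<Rightarrow> bool" where
  "maximum_scattered \<iota> U \<longleftrightarrow>
     module.subspace (\<lambda>c. pair_scale (\<iota> c)) U \<and>
     vector_space.dim (\<lambda>c. pair_scale (\<iota> c)) U = ext_degree \<iota> \<and>
     card {module.span pair_scale {u} | u. u \<in> U - {0}} =
       (CARD('k) ^ ext_degree \<iota> - 1) div (CARD('k) - 1)"

end

theory Submission
  imports Defs
begin

text \<open>
  The code of \<open>f\<close> is MRD with minimum distance 5 as soon as $f(x) y = f(y) x$ forces $x / y$ into
  the base field. For the trinomial $g$ this is shown with the Pluecker coordinates
  $p_{ij} = x^{q^i} y^{q^j} - x^{q^j} y^{q^i}$: the relation determines them all by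
  $u = p_{01}$ and $p_{02}$, forces $u^{q^3} = -u$, and finally a cubic equation in
  $u, u^q, u^{q^2}$ which, because $b^2 + b = 1$, splits into conjugates of
  $u - (1 + b) u^q$; no nonzero $u$ is a root.

  The left stabiliser of each code consists of the scalars. An equivalence without transposition
  therefore is, up to a field automorphism, composition with a map $H$ on the right such that
  $H$ and $g \circ H$ both lie in the code of $f$; comparing coefficients gives $H = 0$.
  An equivalence with transposition would embed the $q^6$ scalars into the right stabiliser of the
  code of $g$, which consists of the scalars of the quadratic extension only.
\<close>

section \<open>Finite fields and Frobenius powers\<close>

text \<open>The relation and its conjugates are linear in the p_ij. They reach every coordinate with
  index difference 1 or 3, but not p_02, and the quadratic Pluecker relations yield only products of
  conjugates of v = p_02. The missing link is the common slope m = g(x)/x = g(y)/y: it turns m v and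
  m v^(q^4) into linear forms in the conjugates of u. Eliminating m leaves a linear relation between
  two conjugates of v that are two Frobenius steps apart; multiplied by the conjugate between them,
  it becomes the cubic in u alone. The constant 1 + b is the inverse of b, because b^2 + b = 1. An
  untransposed equivalence is treated by coefficients rather than by the size of right stabilisers:
  scalars e with e^(q^2) = e also act on the right of the codes with exponents s and 6 - s.\<close>

lemma finite_field_power_card:
  fixes x :: "'a::{field,finite}"
  shows "x ^ CARD('a) = x"
proof (cases "x = 0")
  case False
  have "x * (\<Prod>y\<in>UNIV-{0}. x * y) = x * x ^ (CARD('a) - 1) * \<Prod>(UNIV-{0})"
    by (simp add: prod.distrib mult_ac)
  also have "x * x ^ (CARD('a) - 1) = x ^ CARD('a)"
    by (metis power_Suc Suc_diff_1 finite_UNIV_card_ge_0 finite)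
  also have "(\<Prod>y\<in>UNIV-{0}. x * y) = (\<Prod>y\<in>UNIV-{0}. y)"
    by (rule prod.reindex_bij_witness[of _ "\<lambda>y. y / x" "\<lambda>y. x * y"]) (use False in auto)
  finally show ?thesis
    by simp
qed (simp add: finite_UNIV_card_ge_0)

text \<open>(X + 1)^Q and X^Q + 1 take equal values on the whole field. Their leading coefficients
  agree too, so the difference has degree below Q but Q roots, and vanishes. This avoids writing Q
  as a prime power.\<close>

lemma of_nat_card_choose_eq_0:
  assumes "0 < i" "i < CARD('a)"
  shows "of_nat (CARD('a) choose i) = (0 :: 'a::{field,finite})"
proof -
  let ?Q = "CARD('a)"
  have Q: "?Q > 0" by (simp add: finite_UNIV_card_ge_0)
  have "[:1, 1:] ^ ?Q = (Polynomial.monom 1 ?Q + 1 :: 'a poly)"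
  proof (rule poly_eqI_degree_lead_coeff[where A = UNIV and n = ?Q])
    show "Polynomial.coeff ([:1, 1:] ^ ?Q :: 'a poly) ?Q = Polynomial.coeff (Polynomial.monom 1 ?Q + 1) ?Q"
      using Q by (simp add: coeff_linear_poly_power)
    show "Polynomial.degree ([:1, 1:] ^ ?Q :: 'a poly) \<le> ?Q"
      by (simp add: degree_linear_power)
    show "Polynomial.degree (Polynomial.monom 1 ?Q + 1 :: 'a poly) \<le> ?Q"
      by (intro degree_add_le degree_monom_le) simp
  qed (simp_all add: poly_monom finite_field_power_card)
  then have "Polynomial.coeff ([:1, 1:] ^ ?Q :: 'a poly) i = Polynomial.coeff (Polynomial.monom 1 ?Q + 1) i"
    by simp
  then show ?thesis
    using assms by (simp add: coeff_linear_poly_power)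
qed

lemma field_hom_simps:
  assumes "field_hom h"
  shows "h (x + y) = h x + h y" "h (x * y) = h x * h y" "h 1 = 1" "h 0 = 0"
    "h (- x) = - h x" "h (x - y) = h x - h y" "h (of_nat n) = of_nat n" "h (x ^ n) = h x ^ n"
    "h x = 0 \<longleftrightarrow> x = 0" "inj h"
proof -
  show add: "h (x + y) = h x + h y" and mult: "h (x * y) = h x * h y" and one: "h 1 = 1" for x y
    using assms unfolding field_hom_def ring_of_type_algebra_def
    by (auto simp: ring_hom_def)
  show zero: "h 0 = 0"
    using add[of 0 0] by (metis add_0 add_cancel_left_left)
  show minus: "h (- x) = - h x" for x
    using add[of x "- x"] zero by (simp add: eq_neg_iff_add_eq_0 add.commute)
  show diff: "h (x - y) = h x - h y" for x y
    using add[of x "- y"] minus by simp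
  show "h (of_nat n) = of_nat n"
    by (induction n) (simp_all add: zero add one)
  show "h (x ^ n) = h x ^ n"
    by (induction n) (simp_all add: mult one)
  show nz: "h x = 0 \<longleftrightarrow> x = 0" for x
    using mult[of x "inverse x"] one zero by (cases "x = 0") auto
  show "inj h"
    by (rule injI) (use diff nz in \<open>metis eq_iff_diff_eq_0\<close>)
qed

lemma field_aut_imp_hom: "field_aut \<sigma> \<Longrightarrow> field_hom \<sigma>"
  and field_aut_imp_bij: "field_aut \<sigma> \<Longrightarrow> bij \<sigma>"
  by (auto simp: field_aut_def field_hom_def ring_iso_def ring_of_type_algebra_def)

section \<open>The extension of degree six and its Frobenius powers\<close>

locale sextic_extension =
  fixes \<iota> :: "'k::{field,finite} \<Rightarrow> 'l::{field,finite}" and q :: nat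
  assumes card_base: "CARD('k) = q" and card_ext: "CARD('l) = q ^ 6"
    and hom: "field_hom \<iota>"
begin

lemmas \<iota>_simps = field_hom_simps[OF hom]

lemma q_gt_1: "q > 1"
proof -
  have "card {0, 1 :: 'k} \<le> CARD('k)" by (intro card_mono) auto
  then show ?thesis using card_base by simp
qed

lemma power_q6 [simp]: "x ^ (q ^ 6) = (x :: 'l)"
  using finite_field_power_card[of x] card_ext by simp

lemma \<iota>_power_q [simp]: "\<iota> k ^ q = \<iota> k"
  using finite_field_power_card[of k] card_base \<iota>_simps(8) by metis

lemma add_power_q: "(x + y) ^ q = x ^ q + (y ^ q :: 'l)"
proof -
  have "of_nat (q choose i) = (0 :: 'l)" if "0 < i" "i < q" for i
    using of_nat_card_choose_eq_0[where 'a = 'k, of i] that card_base \<iota>_simps(4,7) by metis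
  then have "(x + y) ^ q = (\<Sum>i\<in>{0, q}. of_nat (q choose i) * x ^ i * y ^ (q - i))"
    unfolding binomial_ring by (intro sum.mono_neutral_right) auto
  then show ?thesis
    using q_gt_1 by (simp add: add.commute)
qed

definition frob :: "nat \<Rightarrow> 'l \<Rightarrow> 'l" where
  "frob i x = x ^ (q ^ i)"

lemma frob_Suc: "frob (Suc i) x = frob i x ^ q"
  by (simp add: frob_def mult.commute flip: power_mult)

lemma frob_0 [simp]: "frob 0 x = x"
  by (simp add: frob_def)

lemma frob_add: "frob i (x + y) = frob i x + frob i y"
  by (induction i) (simp_all add: frob_Suc add_power_q)

lemma frob_mult: "frob i (x * y) = frob i x * frob i y"
  by (simp add: frob_def power_mult_distrib)

lemma frob_eq_0 [simp]: "frob i x = 0 \<longleftrightarrow> x = 0"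
  using q_gt_1 by (simp add: frob_def)

lemma frob_of_0 [simp]: "frob i 0 = 0"
  by simp

lemma frob_of_1 [simp]: "frob i 1 = 1"
  by (simp add: frob_def)

lemma frob_minus: "frob i (- x) = - frob i x"
  using frob_add[of i x "- x"] by (simp add: eq_neg_iff_add_eq_0 add.commute)

lemma frob_diff: "frob i (x - y) = frob i x - frob i y"
  using frob_add[of i x "- y"] frob_minus by simp

lemma frob_frob: "frob i (frob j x) = frob (i + j) x"
  by (simp add: frob_def power_add mult.commute flip: power_mult)

lemma frob_\<iota> [simp]: "frob i (\<iota> k) = \<iota> k"
  by (induction i) (simp_all add: frob_Suc)

lemma frob_6 [simp]: "frob 6 x = x"
  by (simp add: frob_def)

lemma frob_add_6: "frob (i + 6) x = frob i x"
  by (simp flip: frob_frob)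

lemma frob_mod_6: "frob (i mod 6) x = frob i x"
proof -
  have "frob (i + 6 * k) x = frob i x" for i k
  proof (induction k)
    case (Suc k)
    have "i + 6 * Suc k = (i + 6 * k) + 6" by simp
    then show ?case using Suc frob_add_6 by metis
  qed simp
  from this[of "i mod 6" "i div 6"] show ?thesis by simp
qed

lemma frob_inj: "frob i x = frob i y \<longleftrightarrow> x = y"
  using frob_eq_0[of i "x - y"] frob_diff[of i x y] by (metis eq_iff_diff_eq_0)

text \<open>Composing two powers with exponents at most 5 gives exponents up to 10, so these
  numerals, besides 6, must be brought back.\<close>

lemma frob_numeral_reduce [simp]:
  "frob 7 x = frob 1 x" "frob 8 x = frob 2 x" "frob 9 x = frob 3 x" "frob 10 x = frob 4 x"
  using frob_mod_6[of 7 x] frob_mod_6[of 8 x] frob_mod_6[of 9 x] frob_mod_6[of 10 x] by simp_all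

text \<open>X^q - X has at most q roots, and the image of the base field already supplies q of
  them.\<close>

lemma fixed_by_frob_iff: "x ^ q = x \<longleftrightarrow> x \<in> range \<iota>"
proof -
  let ?p = "Polynomial.monom 1 q - Polynomial.monom 1 1 :: 'l poly"
  have deg: "Polynomial.degree ?p \<le> q"
    using q_gt_1 by (intro degree_diff_le) (auto intro: degree_monom_le order_trans)
  have "Polynomial.coeff ?p q = 1"
    using q_gt_1 by simp
  then have "?p \<noteq> 0"
    by (metis coeff_0 zero_neq_one)
  then have "card {x. poly ?p x = 0} \<le> q"
    using card_poly_roots_bound deg order_trans by blast
  moreover have "card (range \<iota>) = q"
    using \<iota>_simps(10) card_base by (simp add: card_image)
  moreover have sub: "range \<iota> \<subseteq> {x. poly ?p x = 0}"
    by (auto simp: poly_monom)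
  ultimately have "range \<iota> = {x. poly ?p x = 0}"
    by (intro card_seteq) auto
  then show ?thesis
    by (auto simp: poly_monom)
qed

section \<open>Coefficients of q-polynomials\<close>

definition qpoly :: "(nat \<Rightarrow> 'l) \<Rightarrow> 'l \<Rightarrow> 'l" where
  "qpoly c x = (\<Sum>i<6. c i * frob i x)"

text \<open>The polynomial behind \<open>qpoly\<close> has degree at most q^5, below the q^6 points
  of the field, so equal functions are equal polynomials. All comparisons of coefficients rest on
  this.\<close>

lemma qpoly_eqD:
  assumes "\<And>x. qpoly c x = qpoly d x" "i < 6"
  shows "c i = d i"
proof -
  let ?P = "\<lambda>c. (\<Sum>i<6. Polynomial.monom (c i) (q ^ i)) :: 'l poly"
  have poly: "poly (?P c) x = qpoly c x" for c x
    by (simp add: poly_sum poly_monom qpoly_def frob_def)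
  have deg: "Polynomial.degree (?P c) < q ^ 6" for c
  proof -
    have "Polynomial.degree (?P c) \<le> q ^ 5"
      using q_gt_1 by (intro degree_sum_le) (auto intro!: order_trans[OF degree_monom_le] power_increasing)
    also have "\<dots> < q ^ 6"
      using q_gt_1 by (intro power_strict_increasing) auto
    finally show ?thesis .
  qed
  have "?P c = ?P d"
    by (rule poly_eqI_degree[where A = UNIV]) (use poly deg assms card_ext in simp_all)
  then have "Polynomial.coeff (?P c) (q ^ i) = Polynomial.coeff (?P d) (q ^ i)"
    by simp
  moreover have "Polynomial.coeff (?P c) (q ^ i) = c i" for c
  proof -
    have "Polynomial.coeff (?P c) (q ^ i) = (\<Sum>j<6. if j = i then c j else 0)"
      unfolding coeff_sum using q_gt_1 by (intro sum.cong) auto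
    then show ?thesis
      using assms(2) by simp
  qed
  ultimately show ?thesis
    by simp
qed

lemma frob_neq:
  assumes "i < 6" "j < 6" "i \<noteq> j"
  obtains x where "frob i x \<noteq> frob j x"
proof -
  have "qpoly (\<lambda>k. if k = i then 1 else 0) x = frob i x" if "i < 6" for i x
  proof -
    have "(\<Sum>k<6. (if k = i then 1 else 0) * frob k x) = (\<Sum>k<6. if k = i then frob k x else 0)"
      by (intro sum.cong) auto
    then show ?thesis using that by (simp add: qpoly_def)
  qed
  then show thesis
    using qpoly_eqD[of "\<lambda>k. if k = i then 1 else 0" "\<lambda>k. if k = j then 1 else 0" i] assms that
    by (metis one_neq_zero)
qed

end

section \<open>Scattered polynomials and stabilisers of codes\<close>

declare One_nat_def [simp del]

section \<open>Identities for a root of b^2 + b = 1\<close>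

lemma golden_ratio_neq:
  fixes b :: "'a::field"
  assumes "b\<^sup>2 + b = 1"
  shows "b \<noteq> 0" "b \<noteq> 1"
  using assms by (auto, metis add_cancel_right_right one_add_one zero_neq_one)

text \<open>Multiplied by b, both sides equal m v v': the equation for b reduces the hypotheses to m
  v = b (y - b z) and m v' = b^2 (x + y). The slope m is never inverted, so it may be zero.\<close>

lemma golden_ratio_linear_relation:
  fixes b :: "'a::field"
  assumes b: "b\<^sup>2 + b = 1"
    and "m * v = y - z - b * (b * y - z)" and "m * v' = - (b * x - y) + x - b * y"
  shows "b * (x + y) * v = (y - b * z) * v'"
proof -
  have "m * v = b * (y - b * z)"
    using assms(1,2) by Groebner_Basis.algebra
  moreover have "m * v' = b\<^sup>2 * (x + y)"
    using assms(1,3) by Groebner_Basis.algebra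
  ultimately have "b * (b * (x + y) * v) = b * ((y - b * z) * v')"
    by Groebner_Basis.algebra
  then show ?thesis
    using golden_ratio_neq[OF b] by simp
qed

text \<open>Multiplying the linear relation by \<open>v\<^sub>1\<close> lets both products be
  replaced. What remains is a cubic in x, y, z that equals -b^3 times the product of the three
  factors. Under the cycle x to y to z to -x, which Frobenius induces later, each factor goes to the
  next up to sign.\<close>

lemma golden_ratio_cubic_splits:
  fixes b :: "'a::field"
  assumes b: "b\<^sup>2 + b = 1" and "b * (z - x) * v\<^sub>2 = (b * y - x) * v\<^sub>0"
    and "v\<^sub>0 * v\<^sub>1 = x * z - b * y * z - x * y" and "v\<^sub>1 * v\<^sub>2 = - x * y + b * x * z - y * z"
  shows "x = (1 + b) * y \<or> y = (1 + b) * z \<or> z = - (1 + b) * x"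
proof -
  have "b * (z - x) * (- x * y + b * x * z - y * z) = (b * y - x) * (x * z - b * y * z - x * y)"
    using assms by Groebner_Basis.algebra
  then have "(x - (1 + b) * y) * (y - (1 + b) * z) * (z - (- (1 + b) * x)) = 0"
    using b by Groebner_Basis.algebra
  then show ?thesis
    by simp
qed

text \<open>The equation says ((1 + b)^3 + 1) x = 0, where (1 + b)^3 + 1 = 2 (1 + b)^2 and 1 + b is
  inverse to b.\<close>

lemma golden_ratio_cube:
  fixes b :: "'a::field"
  assumes b: "b\<^sup>2 + b = 1" and "x = (1 + b) * ((1 + b) * ((1 + b) * - x))" and two: "(2 :: 'a) \<noteq> 0"
  shows "x = 0"
proof -
  have "2 * x = 0"
    using assms(1,2) by Groebner_Basis.algebra
  then show ?thesis
    using two by simp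
qed

section \<open>Scattered polynomials\<close>

context sextic_extension
begin

lemma sum_lessThan_6: "(\<Sum>i<6. h i) = h 0 + h 1 + h 2 + h 3 + h 4 + h (5::nat)"
  by (simp add: eval_nat_numeral One_nat_def)

text \<open>Written without quotients, so that x = 0 or y = 0 is no exception. The conclusion is the
  vanishing of p_01.\<close>

definition scattered :: "('l \<Rightarrow> 'l) \<Rightarrow> bool" where
  "scattered f \<longleftrightarrow> (\<forall>x y. f x * y = f y * x \<longrightarrow> x * frob 1 y = y * frob 1 x)"

lemma scattered_frob_1: "scattered (frob 1)"
  by (simp add: scattered_def mult.commute)

lemma scattered_frob_5: "scattered (frob 5)"
  unfolding scattered_def
proof (intro allI impI)
  fix x y
  assume "frob 5 x * y = frob 5 y * x"
  then have "frob 1 (frob 5 x * y) = frob 1 (frob 5 y * x)"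
    by simp
  then show "x * frob 1 y = y * frob 1 x"
    by (simp add: frob_mult frob_frob)
qed

text \<open>The exponent turns x into the product of its six conjugates, which Frobenius permutes
  cyclically.\<close>

lemma norm_frob: "frob s x ^ (\<Sum>i<6. q ^ i) = x ^ (\<Sum>i<6. q ^ i)"
proof -
  have "frob 1 x ^ (\<Sum>i<6. q ^ i) = x ^ (\<Sum>i<6. q ^ i)" for x
  proof -
    have "x ^ (\<Sum>i<6. q ^ i) = (\<Prod>i<6. frob i x)" for x
      by (simp add: power_sum frob_def)
    moreover have "(\<Prod>i<6. h i) = h 0 * h 1 * h 2 * h 3 * h 4 * h 5" for h :: "nat \<Rightarrow> 'l"
      by (simp add: eval_nat_numeral One_nat_def)
    ultimately show ?thesis
      by (simp add: frob_frob mult_ac)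
  qed
  then show ?thesis
    by (induction s) (simp_all add: frob_Suc frob_def[of 1])
qed

text \<open>Because \<open>frob s\<close> inverts \<open>frob t\<close>, it carries the
  \<open>frob t\<close> part A of the cross difference to minus the \<open>frob s\<close> part. The
  hypothesis thus reads A = \<delta> \<open>frob s A\<close>, and taking norms leaves A = 0 unless
  \<delta> has norm 1.\<close>

lemma scattered_binomial_inverse:
  assumes inv: "\<And>x. frob s (frob t x) = x" and t: "scattered (frob t)"
    and norm: "\<delta> ^ (\<Sum>i<6. q ^ i) \<noteq> 1"
  shows "scattered (\<lambda>x. \<delta> * frob s x + frob t x)"
  unfolding scattered_def
proof (intro allI impI)
  fix x y
  assume eq: "(\<delta> * frob s x + frob t x) * y = (\<delta> * frob s y + frob t y) * x"
  define A where "A = frob t x * y - frob t y * x"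
  have "frob s A = x * frob s y - y * frob s x"
    by (simp add: A_def frob_diff frob_mult inv)
  then have "A - \<delta> * frob s A = 0"
    using eq by (simp only:) (simp add: A_def algebra_simps)
  then have "A = \<delta> * frob s A"
    by simp
  then have "A ^ (\<Sum>i<6. q ^ i) = \<delta> ^ (\<Sum>i<6. q ^ i) * A ^ (\<Sum>i<6. q ^ i)"
    by (metis norm_frob power_mult_distrib)
  then have "A = 0"
    using norm by auto
  then show "x * frob 1 y = y * frob 1 x"
    using t unfolding scattered_def A_def by auto
qed

text \<open>With $w = p_{03}$, the hypothesis reads $u + w = b u^{q^5}$. Since $w^{q^3} = -w$, the sum
  $T = u + u^{q^3}$ satisfies $T = b T^{q^2}$, hence $T = b^3 T$ and $T = 0$. The Pluecker relations
  then eliminate $v = p_{02}$.\<close>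

lemma scattered_trinomial:
  assumes b: "b\<^sup>2 + b = 1" and fixed_b: "frob 1 b = b" and two: "(2 :: 'l) \<noteq> 0"
  shows "scattered (\<lambda>x. frob 1 x + frob 3 x + b * frob 5 x)"
  unfolding scattered_def
proof (intro allI impI)
  fix x y
  assume eq: "(frob 1 x + frob 3 x + b * frob 5 x) * y = (frob 1 y + frob 3 y + b * frob 5 y) * x"
  have frob_b [simp]: "frob i b = b" for i
    using fixed_b by (induction i) (simp_all add: frob_Suc frob_def[of 1])
  have b0: "b \<noteq> 0"
    using b by auto
  define p where "p i j = frob i x * frob j y - frob j x * frob i y" for i j
  have frob_p: "frob k (p i j) = p (k + i) (k + j)" for k i j
    by (simp add: p_def frob_diff frob_mult frob_frob)
  have p6: "p i 6 = p i 0" "p i 7 = p i 1" "p 6 i = p 0 i" "p 7 i = p 1 i" "p i 8 = p i 2"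
    "p 8 i = p 2 i" "p i 9 = p i 3" "p 9 i = p 3 i" for i
    by (simp_all add: p_def)
  define u v where "u = p 0 1" and "v = p 0 2"
  have frob_u: "frob 1 u = p 1 2" "frob 2 u = p 2 3" "frob 3 u = p 3 4" "frob 4 u = p 4 5"
    "frob 5 u = p 5 0"
    by (simp_all add: u_def frob_p p6)
  have frob_v: "frob 1 v = p 1 3" "frob 2 v = p 2 4" "frob 4 v = p 4 0"
    by (simp_all add: v_def frob_p p6)
  have E: "u + p 0 3 = b * frob 5 u"
  proof -
    have "u + p 0 3 - b * frob 5 u =
        (frob 1 y + frob 3 y + b * frob 5 y) * x - (frob 1 x + frob 3 x + b * frob 5 x) * y"
      unfolding frob_u unfolding u_def p_def by (simp add: algebra_simps)
    then show ?thesis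
      using eq by simp
  qed
  have u3: "frob 3 u = - u"
  proof -
    define T where "T = u + frob 3 u"
    have "frob 3 (u + p 0 3) = frob 3 (b * frob 5 u)"
      using E by simp
    then have "frob 3 u - p 0 3 = b * frob 2 u"
      by (simp add: frob_add frob_mult frob_frob frob_p p6) (simp add: p_def algebra_simps)
    moreover have "T = (u + p 0 3) + (frob 3 u - p 0 3)"
      by (simp add: T_def)
    ultimately have "T = b * frob 5 u + b * frob 2 u"
      unfolding E by simp
    moreover have "frob 2 T = frob 2 u + frob 5 u"
      by (simp add: T_def frob_add frob_frob)
    ultimately have T: "T = b * frob 2 T"
      by (simp add: distrib_left)
    have 1: "frob 2 T = b * frob 4 T"
      using arg_cong[OF T, of "frob 2"] by (simp add: frob_mult frob_frob)
    have 2: "frob 4 T = b * T"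
      using arg_cong[OF T, of "frob 4"] by (simp add: frob_mult frob_frob)
    have "T = b * (b * (b * T))"
      using T unfolding 1 2 .
    \<comment> \<open>This is 1 - b^3 = 2 b^2, written as a polynomial identity with an explicit
      multiple of b^2 + b - 1. Odd characteristic is what makes it force T = 0.\<close>
    moreover have "2 * (b\<^sup>2 * T) = (T - b * (b * (b * T))) + (b\<^sup>2 + b - 1) * (b + 1) * T"
      by (simp add: algebra_simps power2_eq_square)
    ultimately have "2 * (b\<^sup>2 * T) = 0"
      unfolding b by simp
    then have "T = 0"
      using two b0 by simp
    then show ?thesis
      by (simp add: T_def eq_neg_iff_add_eq_0 add.commute)
  qed
  \<comment> \<open>By \<open>u3\<close> every conjugate of u is one of these up to sign, and so
    each p_ij with index difference 1 or 3 is a linear form in them.\<close>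
  define U\<^sub>0 U\<^sub>1 U\<^sub>2 where "U\<^sub>0 = u" and "U\<^sub>1 = frob 1 u" and "U\<^sub>2 = frob 2 u"
  have u4: "frob 4 u = - U\<^sub>1" and u5: "frob 5 u = - U\<^sub>2"
    using arg_cong[OF u3, of "frob 1"] arg_cong[OF u3, of "frob 2"]
    by (simp_all add: U\<^sub>1_def U\<^sub>2_def frob_frob frob_minus)
  have w0: "p 0 3 = - b * U\<^sub>2 - U\<^sub>0"
    using E u5 by (simp add: U\<^sub>0_def algebra_simps)
  have w1: "p 1 4 = b * U\<^sub>0 - U\<^sub>1"
    using arg_cong[OF E, of "frob 1"] by (simp add: frob_p frob_add frob_mult frob_frob U\<^sub>0_def U\<^sub>1_def algebra_simps)
  have w2: "p 2 5 = b * U\<^sub>1 - U\<^sub>2"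
    using arg_cong[OF w1, of "frob 1"] by (simp add: frob_p frob_diff frob_mult frob_frob U\<^sub>0_def U\<^sub>1_def U\<^sub>2_def)
  have plucker1: "v * frob 1 v = U\<^sub>0 * U\<^sub>2 - b * U\<^sub>1 * U\<^sub>2 - U\<^sub>0 * U\<^sub>1"
  proof -
    \<comment> \<open>The relation p_01 p_23 - p_02 p_13 + p_03 p_12 = 0.\<close>
    have "u * frob 2 u - v * frob 1 v + p 0 3 * frob 1 u = 0"
      unfolding frob_u frob_v unfolding u_def v_def p_def by (simp add: algebra_simps)
    then show ?thesis
      unfolding w0 U\<^sub>1_def[symmetric] U\<^sub>2_def[symmetric] by (simp add: U\<^sub>0_def algebra_simps)
  qed
  have plucker2: "frob 1 v * frob 2 v = - U\<^sub>0 * U\<^sub>1 + b * U\<^sub>0 * U\<^sub>2 - U\<^sub>1 * U\<^sub>2"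
    using arg_cong[OF plucker1, of "frob 1"] u3
    by (simp add: frob_mult frob_frob frob_diff U\<^sub>0_def U\<^sub>1_def U\<^sub>2_def mult_ac)
  \<comment> \<open>The common slope of the two points, read off from whichever of x and y is
    nonzero. If both vanish, division by zero gives m = 0, which still satisfies both
    equations.\<close>
  obtain m where m: "frob 1 x + frob 3 x + b * frob 5 x = m * x" "frob 1 y + frob 3 y + b * frob 5 y = m * y"
  proof (cases "x = 0")
    case True
    show thesis
      by (rule that[of "(frob 1 y + frob 3 y + b * frob 5 y) / y"]) (use True in auto)
  next
    case False
    show thesis
      by (rule that[of "(frob 1 x + frob 3 x + b * frob 5 x) / x"]) (use False eq in \<open>auto simp: field_simps\<close>)
  qed
  have "m * v = (m * x) * frob 2 y - (m * y) * frob 2 x"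
    by (simp add: v_def p_def algebra_simps)
  then have mv0: "m * v = U\<^sub>1 - U\<^sub>2 - b * p 2 5"
    unfolding m[symmetric] U\<^sub>1_def U\<^sub>2_def frob_u unfolding p_def by (simp add: algebra_simps)
  \<comment> \<open>The slope acts only on entries with Frobenius index 0. Besides v = p_02, the
    only conjugate of v containing that index is p_40, which is \<open>frob 4 v\<close>.\<close>
  have "m * frob 4 v = (m * y) * frob 4 x - (m * x) * frob 4 y"
    by (simp add: frob_v p_def algebra_simps)
  then have mv4: "m * frob 4 v = - p 1 4 - frob 3 u + b * frob 4 u"
    unfolding m[symmetric] frob_u unfolding p_def by (simp add: algebra_simps)
  have "b * (U\<^sub>0 + U\<^sub>1) * v = (U\<^sub>1 - b * U\<^sub>2) * frob 4 v"
    by (rule golden_ratio_linear_relation[OF b mv0[unfolded w2]])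
      (simp add: mv4 w1 u3 u4 U\<^sub>0_def)
  \<comment> \<open>This returns \<open>frob 4 v\<close> to v. The relation then links v and
    \<open>frob 2 v\<close>, the partners of \<open>frob 1 v\<close> in the two Pluecker
    products.\<close>
  from arg_cong[OF this, of "frob 2"]
  have "b * (U\<^sub>2 - U\<^sub>0) * frob 2 v = (b * U\<^sub>1 - U\<^sub>0) * v"
    using u3 u4 by (simp add: frob_mult frob_add frob_diff frob_frob U\<^sub>0_def U\<^sub>1_def U\<^sub>2_def)
  from golden_ratio_cubic_splits[OF b this plucker1 plucker2]
  have 1: "u = (1 + b) * frob 1 u"
  proof (elim disjE)
    assume "U\<^sub>1 = (1 + b) * U\<^sub>2"
    from arg_cong[OF this, of "frob 5"] show ?thesis
      by (simp add: U\<^sub>1_def U\<^sub>2_def frob_mult frob_add frob_frob)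
  next
    assume "U\<^sub>2 = - (1 + b) * U\<^sub>0"
    then have "frob 2 u = (1 + b) * frob 3 u"
      using u3 by (simp add: U\<^sub>0_def U\<^sub>2_def algebra_simps)
    from arg_cong[OF this, of "frob 4"] show ?thesis
      by (simp add: frob_mult frob_add frob_frob)
  qed (simp add: U\<^sub>0_def U\<^sub>1_def)
  have 2: "frob 1 u = (1 + b) * frob 2 u"
    using arg_cong[OF 1, of "frob 1"] by (simp add: frob_mult frob_add frob_frob)
  have 3: "frob 2 u = (1 + b) * frob 3 u"
    using arg_cong[OF 1, of "frob 2"] by (simp add: frob_mult frob_add frob_frob)
  have "u = (1 + b) * ((1 + b) * ((1 + b) * - u))"
    using 1 2 3 u3 by metis
  then have "u = 0"
    by (rule golden_ratio_cube[OF b _ two])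
  then show "x * frob 1 y = y * frob 1 x"
    by (simp add: u_def p_def mult.commute)
qed

section \<open>Stabilisers by comparison of coefficients\<close>

lemma qpoly_explicit:
  "qpoly c x = c 0 * x + c 1 * frob 1 x + c 2 * frob 2 x + c 3 * frob 3 x + c 4 * frob 4 x
    + c 5 * frob 5 x"
  by (simp add: qpoly_def sum_lessThan_6)

lemma qpoly_add_scaled_id:
  "a * qpoly c x + e * x = qpoly (\<lambda>i. a * c i + (if i = 0 then e else 0)) x"
  by (simp add: qpoly_explicit algebra_simps)

lemma qpoly_mult_arg: "qpoly c (k * x) = qpoly (\<lambda>i. c i * frob i k) x"
  by (simp add: qpoly_explicit frob_mult algebra_simps)

text \<open>Coefficient i of the composition collects h at i - 1, i - 3 and i - 5 modulo 6; adding
  5, 3 and 1 instead stays within the natural numbers.\<close>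

lemma trinomial_qpoly:
  "frob 1 (qpoly h x) + frob 3 (qpoly h x) + b * frob 5 (qpoly h x) =
   qpoly (\<lambda>i. frob 1 (h ((i + 5) mod 6)) + frob 3 (h ((i + 3) mod 6)) + b * frob 5 (h ((i + 1) mod 6))) x"
  by (simp add: qpoly_explicit frob_mult frob_add frob_frob numeral_2_eq_2[symmetric] algebra_simps)

lemma endo_code_iff: "h \<in> endo_code f \<longleftrightarrow> (\<exists>a e. h = (\<lambda>x. a * f x + e * x))"
  by (auto simp: endo_code_def)

lemma scale_in_endo_code: "(\<lambda>x. e * x) \<in> endo_code f"
  unfolding endo_code_iff by (intro exI[of _ 0] exI[of _ e]) auto

lemma self_in_endo_code: "f \<in> endo_code f"
  unfolding endo_code_iff by (intro exI[of _ 1] exI[of _ 0]) auto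

text \<open>Ranging over arbitrary maps \<open>\<phi>\<close> lets this be applied to conjugated
  scalars directly; as the identity is a codeword, \<open>\<phi>\<close> lies in the code
  anyway.\<close>

definition left_stabiliser_scalar :: "('l \<Rightarrow> 'l) \<Rightarrow> bool" where
  "left_stabiliser_scalar f \<longleftrightarrow>
     (\<forall>\<phi>. (\<forall>c\<in>endo_code f. \<phi> \<circ> c \<in> endo_code f) \<longrightarrow> (\<exists>e. \<phi> = (\<lambda>x. e * x)))"

text \<open>Scalings are codewords, so \<open>\<phi>\<close> is one and stays one after substituting
  k x for x. The substitution multiplies coefficient l by k^(q^l), yet away from index 0 the result
  must remain proportional to c. Two indices whose Frobenius powers differ at k force a = 0.\<close>

lemma left_stabiliser_scalar_two_terms:
  assumes c0: "c 0 = 0" and ij: "i < 6" "j < 6" "i \<noteq> j" "c i \<noteq> 0" "c j \<noteq> 0"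
  shows "left_stabiliser_scalar (qpoly c)"
  unfolding left_stabiliser_scalar_def
proof (intro allI impI)
  fix \<phi>
  assume \<phi>: "\<forall>h\<in>endo_code (qpoly c). \<phi> \<circ> h \<in> endo_code (qpoly c)"
  have \<phi>_scale: "\<exists>a e. \<forall>x. \<phi> (k * x) = a * qpoly c x + e * x" for k
    using \<phi>[THEN bspec, OF scale_in_endo_code[of k]] unfolding endo_code_iff by (auto simp: fun_eq_iff)
  obtain a e where ae: "\<And>x. \<phi> x = a * qpoly c x + e * x"
    using \<phi>_scale[of 1] by auto
  obtain k where k: "frob i k \<noteq> frob j k"
    using frob_neq ij by metis
  obtain a' e' where ae': "\<And>x. \<phi> (k * x) = a' * qpoly c x + e' * x"
    using \<phi>_scale[of k] by auto
  have eq: "qpoly (\<lambda>i. a * (c i * frob i k) + (if i = 0 then e * k else 0)) x =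
      qpoly (\<lambda>i. a' * c i + (if i = 0 then e' else 0)) x" for x
    using ae[of "k * x"] ae'[of x] by (simp add: qpoly_mult_arg mult.assoc flip: qpoly_add_scaled_id)
  have "a * frob l k = a'" if "l < 6" "c l \<noteq> 0" for l
    using qpoly_eqD[OF eq, of l] that c0 by (cases "l = 0") auto
  then have "a * frob i k = a * frob j k"
    using ij by simp
  then show "\<exists>e. \<phi> = (\<lambda>x. e * x)"
    using k ae by auto
qed

text \<open>With a single term the proportionality argument gives nothing; composing
  \<open>\<phi>\<close> with \<open>frob s\<close> itself creates a foreign term instead.\<close>

lemma left_stabiliser_scalar_frob:
  assumes "s = 1 \<or> s = 5"
  shows "left_stabiliser_scalar (frob s)"
  unfolding left_stabiliser_scalar_def
proof (intro allI impI)
  fix \<phi>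
  assume \<phi>: "\<forall>h\<in>endo_code (frob s). \<phi> \<circ> h \<in> endo_code (frob s)"
  obtain a e where ae: "\<And>x. \<phi> x = a * frob s x + e * x"
    using \<phi>[THEN bspec, OF scale_in_endo_code[of 1]] unfolding endo_code_iff by (auto simp: fun_eq_iff)
  obtain a' e' where ae': "\<And>x. \<phi> (frob s x) = a' * frob s x + e' * x"
    using \<phi>[THEN bspec, OF self_in_endo_code] unfolding endo_code_iff by (auto simp: fun_eq_iff)
  \<comment> \<open>2 s modulo 6, the exponent of \<open>frob s\<close> applied twice; it differs
    from 0 and s.\<close>
  define t :: nat where "t = (if s = 1 then 2 else 4)"
  have "qpoly (\<lambda>i. if i = t then a else if i = s then e else 0) x =
      qpoly (\<lambda>i. if i = s then a' else if i = 0 then e' else 0) x" for x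
    using ae[of "frob s x"] ae'[of x] assms by (auto simp: qpoly_explicit t_def frob_frob algebra_simps)
  from qpoly_eqD[OF this, of t] have "a = 0"
    using assms by (auto simp: t_def)
  then show "\<exists>e. \<phi> = (\<lambda>x. e * x)"
    using ae by auto
qed

text \<open>The alternatives of \<open>support\<close> cover the known families, with indices in {1,
  5}, {1, 4} and {2, 5}. Coefficients 2 and 4 of the composition involve only odd entries of h,
  coefficient 3 only even ones. In the first case all three are zero, and conjugating equation 2
  against equation 4 leaves a factor 1 - b; in the other cases one of those two equations isolates
  \<open>h 1\<close> or \<open>h 5\<close> and gives a = 0. For b only its quadratic equation is
  asked, since a conjugate of b will be inserted.\<close>

lemma no_trinomial_embedding:
  assumes b: "b\<^sup>2 + b = 1"
    and c: "c 0 = 0" "c 3 = 0"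
    and support: "c 2 = 0 \<and> c 4 = 0 \<or> c 1 \<noteq> 0 \<and> c 2 = 0 \<and> c 5 = 0 \<or> c 1 = 0 \<and> c 4 = 0 \<and> c 5 \<noteq> 0"
    and H: "\<And>x. H x = a * qpoly c x + e * x"
    and gH: "\<And>x. frob 1 (H x) + frob 3 (H x) + b * frob 5 (H x) = a' * qpoly c x + e' * x"
  shows "H x = 0"
proof -
  define h where "h i = a * c i + (if i = 0 then e else 0)" for i
  have H: "H x = qpoly h x" for x
    unfolding h_def H qpoly_add_scaled_id ..
  have b0: "b \<noteq> 0" and b1: "b \<noteq> 1"
    using golden_ratio_neq[OF b] by auto
  have "frob 1 (h ((i + 5) mod 6)) + frob 3 (h ((i + 3) mod 6)) + b * frob 5 (h ((i + 1) mod 6)) = a' * c i"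
    if "i < 6" "i \<noteq> 0" for i
    using qpoly_eqD[OF gH[unfolded H trinomial_qpoly qpoly_add_scaled_id], of i] that by simp
  from this[of 2] this[of 3] this[of 4]
  have eqs: "frob 1 (h 1) + frob 3 (h 5) + b * frob 5 (h 3) = a' * c 2"
    "frob 1 (h 2) + frob 3 (h 0) + b * frob 5 (h 4) = a' * c 3"
    "frob 1 (h 3) + frob 3 (h 1) + b * frob 5 (h 5) = a' * c 4"
    by simp_all
  have h: "h 1 = a * c 1" "h 2 = a * c 2" "h 3 = 0" "h 4 = a * c 4" "h 5 = a * c 5"
    using c by (simp_all add: h_def)
  have "h i = 0" if "i < 6" for i
    using support
  proof (elim disjE conjE)
    assume c24: "c 2 = 0" "c 4 = 0"
    then have 1: "frob 1 (h 1) = - frob 3 (h 5)" and 2: "frob 3 (h 1) = - b * frob 5 (h 5)" and "h 0 = 0"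
      using eqs h c by (auto simp: eq_neg_iff_add_eq_0)
    have "frob 3 (h 1) = - frob 5 (h 5)"
      using arg_cong[OF 1, of "frob 2"] by (simp add: frob_frob frob_minus)
    then have "(1 - b) * frob 5 (h 5) = 0"
      using 2 by (simp add: algebra_simps)
    then have "h 5 = 0"
      using b1 by simp
    moreover from this 1 have "h 1 = 0"
      by simp
    moreover have "i = 0 \<or> i = 1 \<or> i = 2 \<or> i = 3 \<or> i = 4 \<or> i = 5"
      using that by linarith
    ultimately show ?thesis
      using h c24 \<open>h 0 = 0\<close> by auto
  next
    assume "c 1 \<noteq> 0" "c 2 = 0" "c 5 = 0"
    then have "a = 0" "h 0 = 0"
      using eqs h c by auto
    then show ?thesis
      by (auto simp: h_def)
  next
    assume "c 1 = 0" "c 4 = 0" "c 5 \<noteq> 0"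
    then have "a = 0" "h 0 = 0"
      using eqs h c b0 by auto
    then show ?thesis
      by (auto simp: h_def)
  qed
  then show ?thesis
    by (simp add: H qpoly_def)
qed

text \<open>The identity is a codeword, so r is one. In the composition the coefficients 1 and 3 see
  only e and give e^q = e^(q^3), while 2 and 4 see only a and must kill it.\<close>

lemma right_stabiliser_trinomial:
  assumes b: "b\<^sup>2 + b = 1" and fixed_b: "frob 1 b = b"
    and r: "\<And>c. c \<in> endo_code (\<lambda>x. frob 1 x + frob 3 x + b * frob 5 x) \<Longrightarrow>
      c \<circ> r \<in> endo_code (\<lambda>x. frob 1 x + frob 3 x + b * frob 5 x)"
  shows "\<exists>e. frob 2 e = e \<and> r = (\<lambda>x. e * x)"
proof -
  define c where "c i = (if i = 1 \<or> i = 3 then 1 else if i = 5 then b else 0)" for i :: nat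
  have g: "(\<lambda>x. frob 1 x + frob 3 x + b * frob 5 x) = qpoly c"
    by (rule ext) (simp add: qpoly_explicit c_def)
  obtain a e where ae: "\<And>x. r x = a * qpoly c x + e * x"
    using r[OF scale_in_endo_code[of 1]] unfolding g endo_code_iff by (auto simp: fun_eq_iff)
  obtain a' e' where ae': "\<And>x. frob 1 (r x) + frob 3 (r x) + b * frob 5 (r x) = a' * qpoly c x + e' * x"
    using r[OF self_in_endo_code] unfolding g endo_code_iff unfolding g[symmetric] by (auto simp: fun_eq_iff)
  define h where "h i = a * c i + (if i = 0 then e else 0)" for i
  have rh: "r x = qpoly h x" for x
    unfolding h_def ae qpoly_add_scaled_id ..
  have "frob 1 (h ((i + 5) mod 6)) + frob 3 (h ((i + 3) mod 6)) + b * frob 5 (h ((i + 1) mod 6)) = a' * c i"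
    if "i < 6" "i \<noteq> 0" for i
    using qpoly_eqD[OF ae'[unfolded rh trinomial_qpoly qpoly_add_scaled_id], of i] that by simp
  from this[of 1] this[of 2] this[of 3] this[of 4]
  have eqs: "frob 1 e = a'" "frob 1 a + frob 3 (a * b) + b * frob 5 a = 0"
    "frob 3 e = a'" "frob 1 a + frob 3 a + b * frob 5 (a * b) = 0"
    by (simp_all add: h_def c_def)
  have "frob 1 (frob 2 e) = frob 1 e"
    using eqs by (simp add: frob_frob)
  then have "frob 2 e = e"
    by (simp only: frob_inj)
  moreover have "a = 0"
  proof -
    have frob_b: "frob i b = b" for i
      using fixed_b by (induction i) (simp_all add: frob_Suc frob_def[of 1])
    have 1: "frob 1 a + b * frob 3 a + b * frob 5 a = 0" "frob 1 a + frob 3 a + b\<^sup>2 * frob 5 a = 0"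
      using eqs by (simp_all add: frob_mult frob_b power2_eq_square mult_ac)
    from arg_cong[OF 1(1), of "frob 2"] have 2: "frob 3 a + b * frob 5 a + b * frob 1 a = 0"
      by (simp add: frob_mult frob_add frob_b frob_frob)
    have "b \<noteq> 1"
      using golden_ratio_neq[OF b] by auto
    moreover have "(1 - b) * (frob 1 a - frob 3 a) =
        (frob 1 a + b * frob 3 a + b * frob 5 a) - (frob 3 a + b * frob 5 a + b * frob 1 a)"
      by (simp add: algebra_simps)
    then have "(1 - b) * (frob 1 a - frob 3 a) = 0"
      unfolding 1 2 by simp
    ultimately have 3: "frob 1 a = frob 3 a"
      by simp
    from arg_cong[OF 3, of "frob 2"] have "frob 3 a = frob 5 a"
      by (simp add: frob_frob)
    with 3 have 4: "frob 5 a = frob 1 a"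
      by simp
    have 5: "(1 + 2 * b) * frob 1 a = 0" "(2 + b\<^sup>2) * frob 1 a = 0"
      using 1 unfolding 4 3[symmetric] by (simp_all add: algebra_simps)
    \<comment> \<open>A Bezout combination of the two factors in 5. The first alone would not do: (1
      + 2 b)^2 = 5, so it vanishes in characteristic 5.\<close>
    have "(2 * b + 2) * (2 + b\<^sup>2) - 3 * (1 + 2 * b) = 2 * b * (b\<^sup>2 + b) - 2 * b + 1"
      by (simp add: algebra_simps power2_eq_square)
    then have "(2 * b + 2) * (2 + b\<^sup>2) - 3 * (1 + 2 * b) = 1"
      unfolding b by simp
    moreover have "((2 * b + 2) * (2 + b\<^sup>2) - 3 * (1 + 2 * b)) * frob 1 a = 0"
      by (simp only: left_diff_distrib mult.assoc 5) simp
    ultimately have "frob 1 a = 0"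
      by (simp only: mult_1)
    then show ?thesis
      by simp
  qed
  ultimately show ?thesis
    using ae by auto
qed

end

section \<open>Rank, minimum distance and middle nucleus\<close>

lemma card_eq_sum_fibres:
  assumes "finite S" "finite T" "g ` S \<subseteq> T"
  shows "card S = (\<Sum>y\<in>T. card {x \<in> S. g x = y})"
  using sum.group[OF assms, of "\<lambda>_. 1 :: nat"] by simp

text \<open>Pairing v with \<open>rank M\<close> vectors that span the rows takes at most |k|^(rank
  M) values. Two vectors in one fibre differ by a kernel element, so every fibre is at most as large
  as the kernel.\<close>

lemma rank_add_kernel_dim_ge:
  fixes M :: "'k::{field,finite}^'n^'m"
  assumes ker: "card {v. M *v v = 0} \<le> CARD('k) ^ d"
  shows "CARD('n) \<le> rank M + d"
proof -
  obtain B where B: "rows M \<subseteq> vec.span B" "card B = rank M"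
    using vec.basis_exists[of "rows M"] unfolding row_rank_def_gen by metis
  define dot where "dot r v = (\<Sum>j\<in>UNIV. r $ j * v $ j)" for r v :: "'k^'n"
  define \<phi> where "\<phi> v = (\<lambda>r\<in>B. dot r v)" for v
  have fibre: "card {v \<in> UNIV. \<phi> v = y} \<le> CARD('k) ^ d" for y
  proof (cases "{v. \<phi> v = y} = {}")
    case False
    then obtain w where w: "\<phi> w = y" by auto
    have "M *v (v - w) = 0" if "\<phi> v = y" for v
    proof -
      have "\<phi> v = \<phi> w"
        using that w by simp
      then have 0: "dot r (v - w) = 0" if "r \<in> B" for r
        using that by (auto simp: \<phi>_def dot_def fun_eq_iff restrict_def algebra_simps sum_subtractf)
          metis
      have "vec.subspace {r. dot r (v - w) = 0}"
        by (rule vec.subspaceI)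
          (auto simp: dot_def distrib_right sum.distrib mult.assoc simp flip: sum_distrib_left)
      then have "vec.span B \<subseteq> {r. dot r (v - w) = 0}"
        using 0 by (intro vec.span_minimal) auto
      then have "dot (row i M) (v - w) = 0" for i
        using B(1) unfolding rows_def by auto
      then show ?thesis
        by (simp add: vec_eq_iff matrix_vector_mult_def dot_def row_def)
    qed
    then have "(\<lambda>v. v - w) ` {v. \<phi> v = y} \<subseteq> {v. M *v v = 0}"
      by auto
    then have "card {v. \<phi> v = y} \<le> card {v. M *v v = 0}"
      by (intro card_inj_on_le[of "\<lambda>v. v - w"]) (auto simp: inj_on_def)
    then show ?thesis
      using ker by simp
  qed simp
  have "CARD('k) ^ CARD('n) = CARD('k^'n)"
    by simp
  also have "\<dots> = (\<Sum>y\<in>B \<rightarrow>\<^sub>E UNIV. card {v \<in> UNIV. \<phi> v = y})"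
    by (rule card_eq_sum_fibres) (auto simp: \<phi>_def intro: finite_PiE)
  also have "\<dots> \<le> card (B \<rightarrow>\<^sub>E (UNIV :: 'k set)) * CARD('k) ^ d"
    using sum_bounded_above[of "B \<rightarrow>\<^sub>E UNIV", OF fibre] by simp
  also have "\<dots> = CARD('k) ^ (rank M + d)"
    by (simp add: card_funcsetE B(2) power_add)
  finally show ?thesis
    using card_mono[of UNIV "{0, 1 :: 'k}"] by (subst (asm) power_increasing_iff) simp_all
qed

lemma rank_less_if_kernel_nontrivial:
  fixes M :: "'k::field^'n^'m"
  assumes "M *v v = 0" "v \<noteq> 0"
  shows "rank M < CARD('n)"
proof -
  have "rank M \<noteq> CARD('n)"
  proof
    assume "rank M = CARD('n)"
    then have "vec.span (rows M) = UNIV"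
      unfolding row_rank_def_gen
      by (metis vec.dim_eq_full vec_dim_card vec.dim_UNIV vec.dimension_def)
    then obtain N where "N ** M = (mat 1 :: 'k^'n^'n)"
      using matrix_left_invertible_span_rows_gen by metis
    then show False
      using assms by (metis matrix_vector_mul_assoc matrix_vector_mul_lid matrix_vector_mult_0_right)
  qed
  then show ?thesis
    using dim_subset_UNIV_cart_gen[of "rows M"] unfolding row_rank_def_gen by simp
qed

lemma module_matrix_scale: "Modules.module (matrix_scale :: 'k::field \<Rightarrow> 'k^'n^'m \<Rightarrow> _)"
  by unfold_locales (simp_all add: matrix_scale_def vec_eq_iff algebra_simps)

lemma module_pair_scale: "Modules.module (pair_scale :: 'l::field \<Rightarrow> _)"
  by unfold_locales (simp_all add: pair_scale_def algebra_simps)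

section \<open>Matrices with respect to the basis\<close>

locale sextic_extension_basis = sextic_extension \<iota> q
  for \<iota> :: "'k::{field,finite} \<Rightarrow> 'l::{field,finite}" and q +
  fixes \<beta> :: "6 \<Rightarrow> 'l"
  assumes basis: "is_basis \<iota> \<beta>"
begin

sublocale ext: vector_space "ext_scale \<iota>"
  by unfold_locales (simp_all add: ext_scale_def \<iota>_simps algebra_simps)

definition coords :: "'l \<Rightarrow> 'k^6" where
  "coords x = (\<chi> i. ext.representation (range \<beta>) x (\<beta> i))"

definition comb :: "'k^6 \<Rightarrow> 'l" where
  "comb v = (\<Sum>i\<in>UNIV. \<iota> (v $ i) * \<beta> i)"

lemma comb_coords [simp]: "comb (coords x) = x"
proof -
  have "(\<Sum>y\<in>range \<beta>. ext_scale \<iota> (ext.representation (range \<beta>) x y) y) = x"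
    using basis unfolding is_basis_def by (intro ext.sum_representation_eq) auto
  then show ?thesis
    using basis unfolding is_basis_def comb_def coords_def
    by (simp add: sum.reindex ext_scale_def)
qed

text \<open>A surjection between two sets of q^6 elements.\<close>

lemma inj_comb: "inj comb"
proof -
  have "surj comb"
    by (metis comb_coords surjI)
  then show ?thesis
    by (intro eq_card_imp_inj_on) (simp_all add: card_base card_ext)
qed

lemma coords_comb [simp]: "coords (comb v) = v"
  using inj_comb comb_coords injD by metis

lemma coords_eq_iff: "coords x = coords y \<longleftrightarrow> x = y"
  by (metis comb_coords)

lemma comb_add: "comb (v + w) = comb v + comb w"
  by (simp add: comb_def \<iota>_simps distrib_right sum.distrib)

lemma comb_0 [simp]: "comb 0 = 0"
  by (simp add: comb_def \<iota>_simps)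

lemma coords_add: "coords (x + y) = coords x + coords y"
  by (metis comb_add comb_coords coords_comb)

lemma coords_0 [simp]: "coords 0 = 0"
  by (metis comb_0 coords_comb)

lemma coords_scale: "coords (\<iota> k * x) = k *s coords x"
proof -
  have "comb (k *s v) = \<iota> k * comb v" for v
    by (simp add: comb_def \<iota>_simps sum_distrib_left mult.assoc)
  then show ?thesis
    by (metis comb_coords coords_comb)
qed

definition base_linear :: "('l \<Rightarrow> 'l) \<Rightarrow> bool" where
  "base_linear f \<longleftrightarrow> (\<forall>x y. f (x + y) = f x + f y) \<and> (\<forall>k x. f (\<iota> k * x) = \<iota> k * f x)"

lemma base_linear_sum:
  assumes "base_linear f"
  shows "f (\<Sum>i\<in>A. h i) = (\<Sum>i\<in>A. f (h i))"
proof -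
  have "f 0 = 0"
    using assms unfolding base_linear_def by (metis add_cancel_left_left)
  then show ?thesis
    using assms by (induction A rule: infinite_finite_induct) (simp_all add: base_linear_def)
qed

lemma endo_matrix_nth: "endo_matrix \<iota> \<beta> f $ i $ j = coords (f (\<beta> j)) $ i"
  by (simp add: endo_matrix_def coords_def)

lemma endo_matrix_mult_vec:
  assumes "base_linear f"
  shows "endo_matrix \<iota> \<beta> f *v v = coords (f (comb v))"
proof -
  have "f (comb v) = (\<Sum>j\<in>UNIV. \<iota> (v $ j) * f (\<beta> j))"
    unfolding comb_def base_linear_sum[OF assms] using assms by (simp add: base_linear_def)
  moreover have "coords (\<Sum>j\<in>A. h j) = (\<Sum>j\<in>A. coords (h j))" for A and h :: "6 \<Rightarrow> 'l"
    by (induction A rule: infinite_finite_induct) (simp_all add: coords_add)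
  ultimately show ?thesis
    by (simp add: vec_eq_iff matrix_vector_mult_def endo_matrix_nth coords_scale
        mult.commute[of "coords _ $ _"])
qed

lemma base_linear_endo_code:
  assumes "base_linear f" "h \<in> endo_code f"
  shows "base_linear h"
  using assms by (auto simp: endo_code_def base_linear_def algebra_simps)

lemma base_linear_qpoly: "base_linear (qpoly c)"
  by (simp add: base_linear_def qpoly_explicit frob_add frob_mult algebra_simps)

text \<open>A nonzero kernel element x0 eliminates e by cross multiplication, so every kernel
  element is a base field multiple of x0.\<close>

lemma card_kernel_le_if_scattered:
  assumes f: "scattered f" and h: "\<And>x. h x = a * f x + e * x" and nz: "a \<noteq> 0 \<or> e \<noteq> 0"
  shows "card {x. h x = 0} \<le> q"
proof (cases "\<exists>x0. x0 \<noteq> 0 \<and> h x0 = 0")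
  case True
  then obtain x0 where x0: "x0 \<noteq> 0" "h x0 = 0" by auto
  then have a: "a \<noteq> 0"
    using nz h by auto
  have "x \<in> (\<lambda>k. \<iota> k * x0) ` UNIV" if "h x = 0" for x
  proof -
    have "a * (f x * x0 - f x0 * x) = h x * x0 - h x0 * x"
      by (simp add: h algebra_simps)
    then have "f x * x0 = f x0 * x"
      using that x0 a by simp
    then have "x * frob 1 x0 = x0 * frob 1 x"
      using f unfolding scattered_def by blast
    then have "(x / x0) ^ q = x / x0"
      using x0 by (simp add: frob_def field_simps)
    then obtain k where "x / x0 = \<iota> k"
      unfolding fixed_by_frob_iff by auto
    then have "x = \<iota> k * x0"
      using x0 by (simp add: field_simps)
    then show ?thesis
      by blast
  qed
  then have "{x. h x = 0} \<subseteq> (\<lambda>k. \<iota> k * x0) ` UNIV"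
    by auto
  then have "card {x. h x = 0} \<le> CARD('k)"
    by (rule surj_card_le[OF finite])
  then show ?thesis
    by (simp add: card_base)
next
  case False
  then have "card {x. h x = 0} \<le> card {0 :: 'l}"
    by (intro card_mono) auto
  then show ?thesis
    using q_gt_1 by simp
qed

lemma endo_code_eq_zeroD:
  assumes f: "scattered f" and z: "\<And>x. a * f x + e * x = 0"
  shows "a = 0 \<and> e = 0"
proof (rule ccontr)
  assume "\<not> (a = 0 \<and> e = 0)"
  then have "card {x. a * f x + e * x = 0} \<le> q"
    using f by (intro card_kernel_le_if_scattered) auto
  moreover have "card {x. a * f x + e * x = 0} = q ^ 6"
    using z card_ext by simp
  ultimately show False
    using q_gt_1 power_strict_increasing[of 1 6 q] by simp
qed

lemma endo_matrix_inj:
  assumes "base_linear f" "base_linear h" "endo_matrix \<iota> \<beta> f = endo_matrix \<iota> \<beta> h"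
  shows "f = h"
proof
  fix x
  have "coords (f x) = coords (h x)"
    using endo_matrix_mult_vec[OF assms(1), of "coords x"] endo_matrix_mult_vec[OF assms(2), of "coords x"]
      assms(3) by simp
  then show "f x = h x"
    by (simp add: coords_eq_iff)
qed

lemma endo_matrix_add:
  "endo_matrix \<iota> \<beta> (\<lambda>x. f x + h x) = endo_matrix \<iota> \<beta> f + endo_matrix \<iota> \<beta> h"
  by (simp add: vec_eq_iff endo_matrix_nth coords_add)

lemma endo_matrix_scale:
  "endo_matrix \<iota> \<beta> (\<lambda>x. \<iota> k * f x) = matrix_scale k (endo_matrix \<iota> \<beta> f)"
  by (simp add: vec_eq_iff endo_matrix_nth coords_scale matrix_scale_def)

lemma endo_matrix_0: "endo_matrix \<iota> \<beta> (\<lambda>x. 0) = 0"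
  by (simp add: vec_eq_iff endo_matrix_nth)

lemma linear_code_matrix_code: "linear_code (matrix_code \<iota> \<beta> f)"
  unfolding linear_code_def
proof (rule Modules.module.subspaceI[OF module_matrix_scale])
  show "0 \<in> matrix_code \<iota> \<beta> f"
    unfolding matrix_code_def
  proof (rule image_eqI)
    show "(\<lambda>x. 0 * x) \<in> endo_code f"
      by (rule scale_in_endo_code)
  qed (simp add: endo_matrix_0)
next
  fix A B
  assume "A \<in> matrix_code \<iota> \<beta> f" "B \<in> matrix_code \<iota> \<beta> f"
  then obtain h h' where h: "h \<in> endo_code f" "h' \<in> endo_code f"
    "A = endo_matrix \<iota> \<beta> h" "B = endo_matrix \<iota> \<beta> h'"
    unfolding matrix_code_def by auto
  have "(\<lambda>x. h x + h' x) \<in> endo_code f"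
  proof -
    obtain a e a' e' where "h = (\<lambda>x. a * f x + e * x)" "h' = (\<lambda>x. a' * f x + e' * x)"
      using h(1,2) unfolding endo_code_iff by auto
    then have "(\<lambda>x. h x + h' x) = (\<lambda>x. (a + a') * f x + (e + e') * x)"
      by (auto simp: algebra_simps)
    then show ?thesis
      unfolding endo_code_iff by blast
  qed
  then show "A + B \<in> matrix_code \<iota> \<beta> f"
    unfolding h(3,4) matrix_code_def endo_matrix_add[symmetric] by blast
next
  fix k A
  assume "A \<in> matrix_code \<iota> \<beta> f"
  then obtain h where h: "h \<in> endo_code f" "A = endo_matrix \<iota> \<beta> h"
    unfolding matrix_code_def by auto
  have "(\<lambda>x. \<iota> k * h x) \<in> endo_code f"
  proof -
    obtain a e where "h = (\<lambda>x. a * f x + e * x)"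
      using h(1) unfolding endo_code_iff by auto
    then have "(\<lambda>x. \<iota> k * h x) = (\<lambda>x. (\<iota> k * a) * f x + (\<iota> k * e) * x)"
      by (auto simp: algebra_simps)
    then show ?thesis
      unfolding endo_code_iff by blast
  qed
  then show "matrix_scale k A \<in> matrix_code \<iota> \<beta> f"
    unfolding h(2) matrix_code_def endo_matrix_scale[symmetric] by blast
qed

lemma rank_ge_5:
  assumes lin: "base_linear f" and f: "scattered f"
    and M: "M \<in> matrix_code \<iota> \<beta> f" "M \<noteq> 0"
  shows "rank M \<ge> 5"
proof -
  obtain a e where h: "M = endo_matrix \<iota> \<beta> (\<lambda>x. a * f x + e * x)"
    using M(1) unfolding matrix_code_def endo_code_def by auto
  have lin_h: "base_linear (\<lambda>x. a * f x + e * x)"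
    using base_linear_endo_code[OF lin] by (auto simp: endo_code_def)
  have "a \<noteq> 0 \<or> e \<noteq> 0"
    using M(2) h endo_matrix_0 by auto
  then have "card {x. a * f x + e * x = 0} \<le> q"
    using f by (intro card_kernel_le_if_scattered) auto
  moreover have "{v. M *v v = 0} \<subseteq> coords ` {x. a * f x + e * x = 0}"
  proof
    fix v
    assume "v \<in> {v. M *v v = 0}"
    then have "coords (a * f (comb v) + e * comb v) = coords 0"
      using endo_matrix_mult_vec[OF lin_h] h by simp
    then have "comb v \<in> {x. a * f x + e * x = 0}"
      unfolding coords_eq_iff by simp
    then show "v \<in> coords ` {x. a * f x + e * x = 0}"
      by (metis coords_comb image_eqI)
  qed
  then have "card {v. M *v v = 0} \<le> card {x. a * f x + e * x = 0}"
    by (rule surj_card_le[OF finite])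
  ultimately have "card {v. M *v v = 0} \<le> CARD('k) ^ 1"
    using card_base by simp
  from rank_add_kernel_dim_ge[OF this] show ?thesis
    by simp
qed

lemma min_distance_matrix_code:
  assumes lin: "base_linear f" and f: "scattered f"
  shows "min_distance (matrix_code \<iota> \<beta> f) = 5"
  unfolding min_distance_def
proof (rule Min_eqI)
  let ?C = "matrix_code \<iota> \<beta> f"
  note sub = linear_code_matrix_code[of f, unfolded linear_code_def]
  show "finite {rank_distance A B |A B. A \<in> ?C \<and> B \<in> ?C \<and> A \<noteq> B}"
    by (rule finite_subset[of _ "(\<lambda>(A, B). rank_distance A B) ` UNIV"]) auto
  show "5 \<le> r" if "r \<in> {rank_distance A B |A B. A \<in> ?C \<and> B \<in> ?C \<and> A \<noteq> B}" for r
  proof -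
    from that obtain A B where AB: "r = rank (A - B)" "A \<in> ?C" "B \<in> ?C" "A \<noteq> B"
      unfolding rank_distance_def by auto
    then have "A - B \<in> ?C"
      using Modules.module.subspace_diff[OF module_matrix_scale sub] by blast
    then show ?thesis
      using rank_ge_5[OF lin f, of "A - B"] AB by simp
  qed
  \<comment> \<open>A word of rank exactly 5: it vanishes at 1, and the coefficient 1 of f keeps it
    from being zero.\<close>
  let ?h = "\<lambda>x. 1 * f x + (- f 1) * x"
  let ?M = "endo_matrix \<iota> \<beta> ?h"
  have h: "?h \<in> endo_code f"
    unfolding endo_code_iff by blast
  have M: "?M \<in> ?C"
    unfolding matrix_code_def using h by blast
  have 0: "0 \<in> ?C"
    using Modules.module.subspace_0[OF module_matrix_scale sub] .
  have nz: "?M \<noteq> 0"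
  proof
    assume "?M = 0"
    then have "?h = (\<lambda>x. 0)"
      by (intro endo_matrix_inj[OF base_linear_endo_code[OF lin h]])
        (simp_all only: endo_matrix_0, simp add: base_linear_def)
    then have "1 * f x + (- f 1) * x = 0" for x
      by meson
    from endo_code_eq_zeroD[OF f this] show False
      by simp
  qed
  have "?M *v coords 1 = 0"
    unfolding endo_matrix_mult_vec[OF base_linear_endo_code[OF lin h]] by simp
  moreover have "coords 1 \<noteq> 0"
    using coords_eq_iff[of 1 0] by simp
  ultimately have "rank ?M < CARD(6)"
    by (rule rank_less_if_kernel_nontrivial)
  then have "rank_distance ?M 0 = 5"
    using rank_ge_5[OF lin f M nz] by (simp add: rank_distance_def)
  then show "5 \<in> {rank_distance A B |A B. A \<in> ?C \<and> B \<in> ?C \<and> A \<noteq> B}"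
    using M 0 nz by (metis (mono_tags, lifting) mem_Collect_eq)
qed

text \<open>12 = 6 (6 - 5 + 1) is the MRD exponent for distance 5.\<close>

lemma card_matrix_code:
  assumes lin: "base_linear f" and f: "scattered f"
  shows "card (matrix_code \<iota> \<beta> f) = q ^ 12"
proof -
  have "matrix_code \<iota> \<beta> f = (\<lambda>(a, e). endo_matrix \<iota> \<beta> (\<lambda>x. a * f x + e * x)) ` UNIV"
    unfolding matrix_code_def endo_code_def by auto
  moreover have "inj (\<lambda>(a, e). endo_matrix \<iota> \<beta> (\<lambda>x. a * f x + e * x))"
  proof (rule injI, clarify)
    fix a e a' e'
    assume eq: "endo_matrix \<iota> \<beta> (\<lambda>x. a * f x + e * x) = endo_matrix \<iota> \<beta> (\<lambda>x. a' * f x + e' * x)"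
    have lin': "base_linear (\<lambda>x. a * f x + e * x)" for a e
      using base_linear_endo_code[OF lin] by (auto simp: endo_code_def)
    have "(\<lambda>x. a * f x + e * x) = (\<lambda>x. a' * f x + e' * x)"
      using endo_matrix_inj[OF lin' lin' eq] .
    then have "(a - a') * f x + (e - e') * x = 0" for x
      using fun_cong[of "\<lambda>x. a * f x + e * x" "\<lambda>x. a' * f x + e' * x" x]
      by (simp add: algebra_simps)
    from endo_code_eq_zeroD[OF f this] show "a = a' \<and> e = e'"
      by simp
  qed
  ultimately have "card (matrix_code \<iota> \<beta> f) = CARD('l \<times> 'l)"
    by (simp add: card_image)
  also have "\<dots> = q ^ 12"
    using card_ext by (simp flip: power_add)
  finally show ?thesis .
qed

lemma middle_nucleus_ring_iso:
  assumes "left_stabiliser_scalar f"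
  shows "middle_nucleus_ring \<iota> (endo_code f) \<simeq> (ring_of_type_algebra :: 'l ring)"
proof -
  have nucleus: "middle_nucleus \<iota> (endo_code f) = range (\<lambda>e x. e * x)"
  proof (intro equalityI subsetI)
    fix \<phi>
    assume "\<phi> \<in> middle_nucleus \<iota> (endo_code f)"
    then show "\<phi> \<in> range (\<lambda>e x. e * x)"
      using assms unfolding middle_nucleus_def left_stabiliser_scalar_def by blast
  next
    fix \<phi> :: "'l \<Rightarrow> 'l"
    assume "\<phi> \<in> range (\<lambda>e x. e * x)"
    then obtain e where \<phi>: "\<phi> = (\<lambda>x. e * x)" by auto
    have "Vector_Spaces.linear (ext_scale \<iota>) (ext_scale \<iota>) \<phi>"
      unfolding Vector_Spaces.linear_iff using ext.vector_space_axioms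
      by (simp add: \<phi> ext_scale_def algebra_simps)
    moreover have "\<phi> \<circ> c \<in> endo_code f" if "c \<in> endo_code f" for c
    proof -
      from that obtain a k where "c = (\<lambda>x. a * f x + k * x)"
        unfolding endo_code_iff by auto
      then have "\<phi> \<circ> c = (\<lambda>x. (e * a) * f x + (e * k) * x)"
        by (auto simp: \<phi> algebra_simps)
      then show ?thesis
        unfolding endo_code_iff by blast
    qed
    ultimately show "\<phi> \<in> middle_nucleus \<iota> (endo_code f)"
      unfolding middle_nucleus_def by blast
  qed
  have "(\<lambda>\<phi>. \<phi> 1) \<in> ring_iso (middle_nucleus_ring \<iota> (endo_code f)) (ring_of_type_algebra :: 'l ring)"
    unfolding middle_nucleus_ring_def ring_of_type_algebra_def nucleus
    by (rule ring_iso_memI) (auto simp: bij_betw_def inj_on_def image_iff)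
  then show ?thesis
    unfolding is_ring_iso_def by blast
qed

lemma linear_MRD_if_scattered:
  assumes "base_linear f" "scattered f" "left_stabiliser_scalar f"
  shows "linear_MRD_with_field_nucleus \<iota> \<beta> 5 f"
  using assms
  by (simp add: linear_MRD_with_field_nucleus_def linear_code_matrix_code min_distance_matrix_code
      is_MRD_def card_matrix_code card_base middle_nucleus_ring_iso)

lemma ext_degree_eq_6: "ext_degree \<iota> = 6"
proof -
  have "ext.dim (ext.span (range \<beta>)) = card (range \<beta>)"
    using basis unfolding is_basis_def by (intro ext.dim_span_eq_card_independent) auto
  also have "card (range \<beta>) = 6"
    using basis unfolding is_basis_def by (simp add: card_image)
  finally show ?thesis
    using basis unfolding is_basis_def ext_degree_def by simp
qed

text \<open>Each point carries, with any (z, f z), its q - 1 nonzero base multiples. The maximal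
  number of points uses up all q^6 - 1 nonzero vectors in this way, whereas a pair violating
  \<open>scattered\<close> would put y on the point of x outside the base multiples of x.\<close>

lemma scattered_if_maximum_scattered:
  assumes lin: "base_linear f" and max: "maximum_scattered \<iota> {(x, f x) | x. True}"
  shows "scattered f"
  unfolding scattered_def
proof (intro allI impI, rule ccontr)
  fix x y
  assume eq: "f x * y = f y * x" and neq: "x * frob 1 y \<noteq> y * frob 1 x"
  have xy: "x \<noteq> 0" "y \<noteq> 0"
    using neq by auto
  define point where "point x = range (\<lambda>c. pair_scale c (x, f x))" for x
  have point_eq: "point z = point (c * z)" if "f (c * z) = c * f z" "c \<noteq> 0" for c z
  proof -
    have "pair_scale k (z, f z) = pair_scale (k / c) (c * z, f (c * z))"
      "pair_scale k (c * z, f (c * z)) = pair_scale (k * c) (z, f z)" for k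
      using that by (simp_all add: pair_scale_def)
    then show ?thesis
      unfolding point_def by (intro equalityI image_subsetI) (metis rangeI)+
  qed
  let ?S = "UNIV - {0 :: 'l}"
  let ?fibre = "\<lambda>s. {z \<in> ?S. point z = s}"
  have scalars: "(\<lambda>k. \<iota> k * z) ` (UNIV - {0}) \<subseteq> ?fibre (point z)" if "z \<noteq> 0" for z
    using that lin point_eq[of "\<iota> k" z for k] by (auto simp: \<iota>_simps base_linear_def)
  have card_scalars: "card ((\<lambda>k. \<iota> k * z) ` (UNIV - {0})) = q - 1" if "z \<noteq> 0" for z
    using that \<iota>_simps(10) by (subst card_image) (auto simp: inj_on_def card_Diff_singleton card_base)
  have "{module.span pair_scale {u} | u. u \<in> {(x, f x) | x. True} - {0}} = point ` ?S"
  proof -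
    have "f 0 = 0"
      using base_linear_sum[OF lin, of id "{}"] by simp
    then have "{(x, f x) | x. True} - {0} = (\<lambda>x. (x, f x)) ` ?S"
      by (auto simp: zero_prod_def)
    then show ?thesis
      unfolding Modules.module.span_singleton[OF module_pair_scale] point_def by auto
  qed
  then have card_points: "card (point ` ?S) = (q ^ 6 - 1) div (q - 1)"
    using max unfolding maximum_scattered_def ext_degree_eq_6 card_base by simp
  have "q ^ 6 - 1 = card ?S"
    by (simp add: card_Diff_singleton card_ext)
  also have "\<dots> = (\<Sum>s\<in>point ` ?S. card (?fibre s))"
    by (rule card_eq_sum_fibres) auto
  also have "\<dots> > (\<Sum>s\<in>point ` ?S. q - 1)"
  proof (rule sum_strict_mono_ex1)
    show "\<forall>s\<in>point ` ?S. q - 1 \<le> card (?fibre s)"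
    proof
      fix s
      assume "s \<in> point ` ?S"
      then obtain z where z: "z \<noteq> 0" "s = point z" by auto
      show "q - 1 \<le> card (?fibre s)"
        using card_mono[OF finite scalars[OF z(1)]] card_scalars[OF z(1)] z(2) by simp
    qed
    show "\<exists>s\<in>point ` ?S. q - 1 < card (?fibre s)"
    proof
      show "point x \<in> point ` ?S"
        using xy by simp
      have "y = (y / x) * x" "f y = (y / x) * f x"
        using xy eq by (simp_all add: field_simps)
      then have "point y = point x"
        using point_eq[of "y / x" x] xy by simp
      moreover have "y \<notin> (\<lambda>k. \<iota> k * x) ` (UNIV - {0})"
        using neq by (auto simp: frob_mult)
      ultimately have "(\<lambda>k. \<iota> k * x) ` (UNIV - {0}) \<subset> ?fibre (point x)"
        using scalars[OF xy(1)] xy by blast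
      from psubset_card_mono[OF finite this] show "q - 1 < card (?fibre (point x))"
        using card_scalars[OF xy(1)] by simp
    qed
  qed simp
  finally have "card (point ` ?S) * (q - 1) < q ^ 6 - 1"
    by simp
  \<comment> \<open>The point count is defined with \<open>div\<close>; divisibility makes it exact,
    so the strict inequality is contradictory.\<close>
  moreover have "(q - 1) dvd (q ^ 6 - 1)"
  proof -
    have "int (q - 1) dvd int (q ^ 6 - 1)"
      using q_gt_1 power_diff_1_eq[of "int q" 6] by (simp add: of_nat_diff)
    then show ?thesis
      by (simp only: int_dvd_int_iff)
  qed
  ultimately show False
    unfolding card_points by simp
qed

end

section \<open>Inequivalence\<close>

definition map_vec :: "('a \<Rightarrow> 'b) \<Rightarrow> 'a^'n \<Rightarrow> 'b^'n" where
  "map_vec \<sigma> v = (\<chi> i. \<sigma> (v $ i))"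

lemma field_hom_sum:
  assumes "field_hom \<sigma>"
  shows "\<sigma> (\<Sum>i\<in>A. h i) = (\<Sum>i\<in>A. \<sigma> (h i))"
  by (induction A rule: infinite_finite_induct) (simp_all add: field_hom_simps[OF assms])

lemma map_matrix_mult_vec:
  assumes "field_hom \<sigma>"
  shows "map_matrix \<sigma> M *v map_vec \<sigma> v = map_vec \<sigma> (M *v v)"
  by (simp add: vec_eq_iff matrix_vector_mult_def map_vec_def field_hom_sum[OF assms]
      field_hom_simps[OF assms])

lemma map_matrix_mult:
  assumes "field_hom \<sigma>"
  shows "map_matrix \<sigma> (M ** N) = map_matrix \<sigma> M ** map_matrix \<sigma> N"
  by (simp add: vec_eq_iff matrix_matrix_mult_def field_hom_sum[OF assms] field_hom_simps[OF assms])

lemma field_hom_inv: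
  assumes "field_aut \<sigma>"
  shows "field_hom (inv_into UNIV \<sigma>)"
  using ring_iso_set_sym[OF ring_from_type_algebra, of \<sigma> ring_of_type_algebra] assms
  by (auto simp: field_aut_def field_hom_def ring_iso_def ring_of_type_algebra_def)

lemma of_nat_card_eq_0: "of_nat CARD('a) = (0 :: 'a::{field,finite})"
proof -
  have "(\<Sum>x\<in>UNIV. x + 1) = (\<Sum>x\<in>UNIV. x :: 'a)"
    by (rule sum.reindex_bij_witness[of _ "\<lambda>x. x - 1" "\<lambda>x. x + 1"]) auto
  then show ?thesis
    by (simp add: sum.distrib)
qed

context sextic_extension_basis
begin

lemma scale_endo_code:
  assumes "c \<in> endo_code f"
  shows "(\<lambda>x. k * c x) \<in> endo_code f"
proof -
  from assms obtain a e where "c = (\<lambda>x. a * f x + e * x)"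
    unfolding endo_code_iff by auto
  then have "(\<lambda>x. k * c x) = (\<lambda>x. (k * a) * f x + (k * e) * x)"
    by (auto simp: algebra_simps)
  then show ?thesis
    unfolding endo_code_iff by blast
qed

lemma comb_endo_matrix_mult_vec:
  assumes "base_linear f"
  shows "comb (endo_matrix \<iota> \<beta> f *v coords x) = f x"
  by (simp add: endo_matrix_mult_vec[OF assms])

text \<open>Conjugation by \<open>A \<circ> \<sigma>\<close> carries the scalars into the left stabiliser of the code of \<open>f\<close>,
  which again consists of scalars; hence \<open>A \<circ> \<sigma>\<close> is a field automorphism \<open>\<rho>\<close> up to a factor, and
  commutes with the Frobenius powers occurring in the trinomial.\<close>

lemma not_equivalent_direct:
  assumes b: "b\<^sup>2 + b = 1" and g: "g = (\<lambda>x. frob 1 x + frob 3 x + b * frob 5 x)" "base_linear g"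
    and c: "c 0 = 0" "c 3 = 0"
    and support: "c 2 = 0 \<and> c 4 = 0 \<or> c 1 \<noteq> 0 \<and> c 2 = 0 \<and> c 5 = 0 \<or> c 1 = 0 \<and> c 4 = 0 \<and> c 5 \<noteq> 0"
    and stab: "left_stabiliser_scalar (qpoly c)"
    and inv: "invertible A" "invertible B" and aut: "field_aut \<sigma>"
  shows "{A ** map_matrix \<sigma> M ** B | M. M \<in> matrix_code \<iota> \<beta> g} \<noteq> matrix_code \<iota> \<beta> (qpoly c)"
proof
  assume eq: "{A ** map_matrix \<sigma> M ** B | M. M \<in> matrix_code \<iota> \<beta> g} = matrix_code \<iota> \<beta> (qpoly c)"
  let ?f = "qpoly c"
  define \<tau> where "\<tau> = inv_into UNIV \<sigma>"
  note \<sigma> = field_aut_imp_hom[OF aut]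
  have \<sigma>\<tau>: "map_vec \<sigma> (map_vec \<tau> v) = v" and \<tau>\<sigma>: "map_vec \<tau> (map_vec \<sigma> v) = v" for v :: "'k^6"
    using field_aut_imp_bij[OF aut]
    by (simp_all add: map_vec_def vec_eq_iff \<tau>_def bij_is_surj surj_f_inv_f bij_is_inj)
  obtain A' where A': "A' ** A = mat 1" "A ** A' = mat 1"
    using inv(1) unfolding invertible_def by blast
  obtain B' where B': "B ** B' = mat 1"
    using inv(2) unfolding invertible_def by blast
  \<comment> \<open>\<Phi> is A after \<sigma> and \<Psi> is the inverse of \<sigma> after B, both
    in coordinates, so that the matrix A M^\<sigma> B acts on the extension as \<Phi> h
    \<Psi>.\<close>
  define \<Phi> where "\<Phi> x = comb (A *v map_vec \<sigma> (coords x))" for x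
  define \<Phi>' where "\<Phi>' x = comb (map_vec \<tau> (A' *v coords x))" for x
  define \<Psi> where "\<Psi> x = comb (map_vec \<tau> (B *v coords x))" for x
  have \<Phi>': "\<Phi>' (\<Phi> x) = x" for x
    by (simp add: \<Phi>_def \<Phi>'_def matrix_vector_mul_assoc A' \<tau>\<sigma>)
  have \<Phi>_add: "\<Phi> (x + y) = \<Phi> x + \<Phi> y" for x y
  proof -
    have "map_vec \<sigma> (v + w) = map_vec \<sigma> v + map_vec \<sigma> w" for v w :: "'k^6"
      by (simp add: map_vec_def vec_eq_iff field_hom_simps[OF \<sigma>])
    then show ?thesis
      by (simp add: \<Phi>_def coords_add matrix_vector_right_distrib comb_add)
  qed
  have conj: "comb ((A ** map_matrix \<sigma> (endo_matrix \<iota> \<beta> h) ** B) *v coords x) = \<Phi> (h (\<Psi> x))"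
    if "h \<in> endo_code g" for h x
  proof -
    have "B *v coords x = map_vec \<sigma> (coords (\<Psi> x))"
      by (simp add: \<Psi>_def \<sigma>\<tau>)
    then have "map_matrix \<sigma> (endo_matrix \<iota> \<beta> h) *v (B *v coords x) = map_vec \<sigma> (coords (h (\<Psi> x)))"
      by (simp add: map_matrix_mult_vec[OF \<sigma>] endo_matrix_mult_vec[OF base_linear_endo_code[OF g(2) that]])
    then show ?thesis
      by (simp add: \<Phi>_def flip: matrix_vector_mul_assoc)
  qed
  have fwd: "(\<lambda>x. \<Phi> (h (\<Psi> x))) \<in> endo_code ?f" if h: "h \<in> endo_code g" for h
  proof -
    have "A ** map_matrix \<sigma> (endo_matrix \<iota> \<beta> h) ** B \<in> matrix_code \<iota> \<beta> ?f"
      using eq h unfolding matrix_code_def by blast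
    then obtain d where d: "d \<in> endo_code ?f"
      "A ** map_matrix \<sigma> (endo_matrix \<iota> \<beta> h) ** B = endo_matrix \<iota> \<beta> d"
      unfolding matrix_code_def by blast
    have "(\<lambda>x. \<Phi> (h (\<Psi> x))) = d"
      using conj[OF h] d comb_endo_matrix_mult_vec[OF base_linear_endo_code[OF base_linear_qpoly d(1)]]
      by auto
    then show ?thesis
      using d(1) by simp
  qed
  have bwd: "\<exists>h\<in>endo_code g. d = (\<lambda>x. \<Phi> (h (\<Psi> x)))" if d: "d \<in> endo_code ?f" for d
  proof -
    have "endo_matrix \<iota> \<beta> d \<in> {A ** map_matrix \<sigma> M ** B | M. M \<in> matrix_code \<iota> \<beta> g}"
      using eq d unfolding matrix_code_def by blast
    then obtain h where h: "h \<in> endo_code g"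
      "A ** map_matrix \<sigma> (endo_matrix \<iota> \<beta> h) ** B = endo_matrix \<iota> \<beta> d"
      unfolding matrix_code_def by auto
    have "d = (\<lambda>x. \<Phi> (h (\<Psi> x)))"
      using conj[OF h(1)] h(2) comb_endo_matrix_mult_vec[OF base_linear_endo_code[OF base_linear_qpoly d]]
      by auto
    then show ?thesis
      using h(1) by blast
  qed
  have "\<exists>e. (\<lambda>x. \<Phi> (k * \<Phi>' x)) = (\<lambda>x. e * x)" for k
  proof -
    have "(\<lambda>x. \<Phi> (k * \<Phi>' x)) \<circ> d \<in> endo_code ?f" if "d \<in> endo_code ?f" for d
    proof -
      from bwd[OF that] obtain h where h: "h \<in> endo_code g" "d = (\<lambda>x. \<Phi> (h (\<Psi> x)))"
        by blast
      then have "(\<lambda>x. \<Phi> (k * \<Phi>' x)) \<circ> d = (\<lambda>x. \<Phi> (k * h (\<Psi> x)))"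
        by (auto simp: \<Phi>')
      then show ?thesis
        using fwd[OF scale_endo_code[OF h(1)]] by simp
    qed
    then show ?thesis
      using stab unfolding left_stabiliser_scalar_def by blast
  qed
  then obtain \<rho> where "\<And>k. (\<lambda>x. \<Phi> (k * \<Phi>' x)) = (\<lambda>x. \<rho> k * x)"
    by metis
  then have \<rho>: "\<Phi> (k * x) = \<rho> k * \<Phi> x" for k x
    using \<Phi>' by metis
  have \<Phi>0: "\<Phi> 0 = 0"
    using \<Phi>_add[of 0 0] by (metis add_0 add_cancel_left_left)
  define w where "w = \<Phi> 1"
  have w: "w \<noteq> 0"
    unfolding w_def using \<Phi>' \<Phi>0 by (metis zero_neq_one)
  have \<Phi>_eq: "\<Phi> x = \<rho> x * w" for x
    using \<rho>[of x 1] by (simp add: w_def)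
  have \<rho>_add: "\<rho> (x + y) = \<rho> x + \<rho> y" for x y
    using \<Phi>_add[of x y] w by (simp add: \<Phi>_eq flip: distrib_right)
  have \<rho>_mult: "\<rho> (x * y) = \<rho> x * \<rho> y" for x y
    using \<rho>[of x y] w by (simp add: \<Phi>_eq)
  have \<rho>_1: "\<rho> 1 = 1"
    using \<Phi>_eq[of 1] w by (simp add: w_def)
  have "\<rho> (x ^ n) = \<rho> x ^ n" for x n
    by (induction n) (simp_all add: \<rho>_1 \<rho>_mult)
  then have \<rho>_frob: "\<rho> (frob i x) = frob i (\<rho> x)" for i x
    by (simp add: frob_def)
  \<comment> \<open>\<rho> may swap the two roots of the equation, so \<open>\<rho> b\<close> need
    not be b; the equation itself survives.\<close>
  have \<rho>b: "(\<rho> b)\<^sup>2 + \<rho> b = 1"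
    using arg_cong[OF b, of \<rho>] by (simp add: \<rho>_add \<rho>_mult \<rho>_1 power2_eq_square)
  have div_w: "\<exists>a e. \<forall>x. \<rho> (h (\<Psi> x)) = a * ?f x + e * x" if h: "h \<in> endo_code g" for h
  proof -
    have "(\<lambda>x. inverse w * \<Phi> (h (\<Psi> x))) \<in> endo_code ?f"
      by (rule scale_endo_code[OF fwd[OF h]])
    moreover have "inverse w * \<Phi> (h (\<Psi> x)) = \<rho> (h (\<Psi> x))" for x
      using w by (simp add: \<Phi>_eq)
    ultimately show ?thesis
      unfolding endo_code_iff by (auto simp: fun_eq_iff)
  qed
  \<comment> \<open>The identity and g, as codewords, yield the two membership facts for H = \<rho>
    \<Psi>; since \<rho> commutes with \<open>frob\<close>, the second concerns the trinomial with
    constant \<open>\<rho> b\<close> composed with H.\<close>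
  obtain a e where H: "\<And>x. \<rho> (\<Psi> x) = a * ?f x + e * x"
    using div_w[OF scale_in_endo_code[of 1]] by auto
  obtain a' e' where gH: "\<And>x. \<rho> (g (\<Psi> x)) = a' * ?f x + e' * x"
    using div_w[OF self_in_endo_code] by auto
  have "\<rho> (\<Psi> x) = 0" for x
  proof (rule no_trinomial_embedding[OF \<rho>b c support H])
    show "frob 1 (\<rho> (\<Psi> x)) + frob 3 (\<rho> (\<Psi> x)) + \<rho> b * frob 5 (\<rho> (\<Psi> x)) = a' * ?f x + e' * x" for x
      unfolding gH[symmetric] g(1) by (simp add: \<rho>_add \<rho>_mult \<rho>_frob)
  qed
  moreover have "\<Psi> (comb (B' *v map_vec \<sigma> (coords 1))) = 1"
    by (simp add: \<Psi>_def matrix_vector_mul_assoc B' \<tau>\<sigma>)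
  ultimately show False
    using \<rho>_1 by (metis zero_neq_one)
qed

text \<open>Through a transposition the scalars in the left stabiliser of the code of \<open>f\<close> become
  $q^6$ elements of the right stabiliser of the code of the trinomial, which has only $q^2$.\<close>

lemma not_equivalent_transposed:
  assumes b: "b\<^sup>2 + b = 1" "frob 1 b = b"
    and g: "g = (\<lambda>x. frob 1 x + frob 3 x + b * frob 5 x)" "base_linear g"
    and f: "base_linear f"
    and inv: "invertible A" "invertible B" and aut: "field_aut \<sigma>"
  shows "{A ** map_matrix \<sigma> (transpose M) ** B | M. M \<in> matrix_code \<iota> \<beta> g} \<noteq> matrix_code \<iota> \<beta> f"
proof
  assume eq: "{A ** map_matrix \<sigma> (transpose M) ** B | M. M \<in> matrix_code \<iota> \<beta> g} = matrix_code \<iota> \<beta> f"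
  define \<tau> where "\<tau> = inv_into UNIV \<sigma>"
  have \<sigma>: "field_hom \<sigma>" and \<tau>: "field_hom \<tau>"
    using aut field_aut_imp_hom field_hom_inv unfolding \<tau>_def by auto
  have \<tau>\<sigma>: "map_matrix \<tau> (map_matrix \<sigma> M) = M" and \<sigma>\<tau>: "map_matrix \<sigma> (map_matrix \<tau> M) = M"
    for M :: "'k^6^6"
    using field_aut_imp_bij[OF aut]
    by (simp_all add: vec_eq_iff \<tau>_def bij_is_surj surj_f_inv_f bij_is_inj)
  obtain A' where A': "A' ** A = mat 1" "A ** A' = mat 1"
    using inv(1) unfolding invertible_def by blast
  obtain B' where B': "B ** B' = mat 1"
    using inv(2) unfolding invertible_def by blast
  define N where "N k = endo_matrix \<iota> \<beta> (\<lambda>x. k * x)" for k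
  have lin_scale: "base_linear (\<lambda>x. k * x)" for k
    by (simp add: base_linear_def algebra_simps)
  \<comment> \<open>The solution of N_k A (M^T)^\<sigma> B = A (M'^T)^\<sigma> B for M' is M times
    this matrix.\<close>
  define R where "R k = transpose (map_matrix \<tau> (A' ** N k ** A))" for k
  have R: "M ** R k \<in> matrix_code \<iota> \<beta> g" if M: "M \<in> matrix_code \<iota> \<beta> g" for M k
  proof -
    have "A ** map_matrix \<sigma> (transpose M) ** B \<in> matrix_code \<iota> \<beta> f"
      using eq M by blast
    then obtain d where d: "d \<in> endo_code f"
      "A ** map_matrix \<sigma> (transpose M) ** B = endo_matrix \<iota> \<beta> d"
      unfolding matrix_code_def by blast
    note lin_d = base_linear_endo_code[OF f d(1)] base_linear_endo_code[OF f scale_endo_code[OF d(1)]]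
    have "N k ** endo_matrix \<iota> \<beta> d = endo_matrix \<iota> \<beta> (\<lambda>x. k * d x)"
      unfolding matrix_eq N_def
      by (simp add: endo_matrix_mult_vec[OF lin_scale] endo_matrix_mult_vec lin_d
          flip: matrix_vector_mul_assoc)
    moreover have "endo_matrix \<iota> \<beta> (\<lambda>x. k * d x) \<in> matrix_code \<iota> \<beta> f"
      unfolding matrix_code_def using scale_endo_code[OF d(1)] by blast
    ultimately obtain M' where M': "M' \<in> matrix_code \<iota> \<beta> g"
      "N k ** (A ** map_matrix \<sigma> (transpose M) ** B) = A ** map_matrix \<sigma> (transpose M') ** B"
      unfolding d(2) eq[symmetric] by auto
    then have "A' ** (N k ** (A ** map_matrix \<sigma> (transpose M) ** B)) ** B' =
        A' ** (A ** map_matrix \<sigma> (transpose M') ** B) ** B'"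
      by simp
    moreover have "A' ** (N k ** (A ** X' ** B)) ** B' = A' ** N k ** A ** X' ** (B ** B')"
      "A' ** (A ** X' ** B) ** B' = (A' ** A) ** X' ** (B ** B')" for X'
      by (simp_all only: matrix_mul_assoc)
    ultimately have "A' ** N k ** A ** map_matrix \<sigma> (transpose M) = map_matrix \<sigma> (transpose M')"
      by (simp add: A' B')
    then have "map_matrix \<tau> (A' ** N k ** A) ** transpose M = transpose M'"
      using map_matrix_mult[OF \<tau>] \<tau>\<sigma> by metis
    then have "M ** R k = M'"
      unfolding R_def by (metis matrix_transpose_mul transpose_transpose)
    then show ?thesis
      using M'(1) by simp
  qed
  have "\<exists>e. frob 2 e = e \<and> (\<lambda>x. comb (R k *v coords x)) = (\<lambda>x. e * x)" for k
  proof (rule right_stabiliser_trinomial[OF b], fold g(1))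
    fix h
    assume h: "h \<in> endo_code g"
    then have "endo_matrix \<iota> \<beta> h ** R k \<in> matrix_code \<iota> \<beta> g"
      by (intro R) (simp add: matrix_code_def)
    then obtain d where d: "d \<in> endo_code g" "endo_matrix \<iota> \<beta> h ** R k = endo_matrix \<iota> \<beta> d"
      unfolding matrix_code_def by auto
    have "d x = h (comb (R k *v coords x))" for x
    proof -
      have "d x = comb ((endo_matrix \<iota> \<beta> h ** R k) *v coords x)"
        unfolding d(2) comb_endo_matrix_mult_vec[OF base_linear_endo_code[OF g(2) d(1)]] ..
      then show ?thesis
        by (simp add: endo_matrix_mult_vec[OF base_linear_endo_code[OF g(2) h]] flip: matrix_vector_mul_assoc)
    qed
    then have "h \<circ> (\<lambda>x. comb (R k *v coords x)) = d"
      by (simp add: fun_eq_iff)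
    then show "h \<circ> (\<lambda>x. comb (R k *v coords x)) \<in> endo_code g"
      using d(1) by simp
  qed
  then obtain \<epsilon> where \<epsilon>: "\<And>k. frob 2 (\<epsilon> k) = \<epsilon> k" "\<And>k. (\<lambda>x. comb (R k *v coords x)) = (\<lambda>x. \<epsilon> k * x)"
    by metis
  have "inj \<epsilon>"
  proof (rule injI)
    fix k k'
    assume "\<epsilon> k = \<epsilon> k'"
    then have "comb (R k *v coords x) = comb (R k' *v coords x)" for x
      using \<epsilon>(2) by metis
    then have "R k *v v = R k' *v v" for v
      using injD[OF inj_comb] by (metis coords_comb)
    then have "R k = R k'"
      by (simp add: matrix_eq)
    then have "A' ** N k ** A = A' ** N k' ** A"
      unfolding R_def transpose_iff using \<sigma>\<tau> by metis
    then have "A ** (A' ** N k ** A) ** A' = A ** (A' ** N k' ** A) ** A'"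
      by simp
    moreover have "A ** (A' ** X' ** A) ** A' = (A ** A') ** X' ** (A ** A')" for X'
      by (simp only: matrix_mul_assoc)
    ultimately have "N k = N k'"
      by (simp add: A')
    then have "(\<lambda>x. k * x) = (\<lambda>x. k' * x)"
      unfolding N_def by (rule endo_matrix_inj[OF lin_scale lin_scale])
    from fun_cong[OF this, of 1] show "k = k'"
      by simp
  qed
  \<comment> \<open>Every element of the extension would then be fixed by
    \<open>frob 2\<close>.\<close>
  then have "surj \<epsilon>"
    by (simp add: finite_UNIV_inj_surj)
  then have "frob 2 x = frob 0 x" for x
    using \<epsilon>(1) by (metis frob_0 surjD)
  then show False
    using frob_neq[of 2 0] by auto
qed

section \<open>The three known families\<close>

lemma two_neq_0:
  assumes "odd q"
  shows "(2 :: 'l) \<noteq> 0"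
proof
  assume two: "(2 :: 'l) = 0"
  obtain m where "q = 2 * m + 1"
    using assms oddE by blast
  then have "of_nat q = (1 :: 'l)"
    using two by simp
  moreover have "of_nat q = (0 :: 'l)"
    using of_nat_card_eq_0[where 'a = 'k] \<iota>_simps(4,7) card_base by metis
  ultimately show False
    by simp
qed

lemma qpoly_code_properties:
  assumes b: "(\<iota> b)\<^sup>2 + \<iota> b = 1"
    and c: "c 0 = 0" "c 3 = 0"
    and support: "c 2 = 0 \<and> c 4 = 0 \<or> c 1 \<noteq> 0 \<and> c 2 = 0 \<and> c 5 = 0 \<or> c 1 = 0 \<and> c 4 = 0 \<and> c 5 \<noteq> 0"
    and stab: "left_stabiliser_scalar (qpoly c)" and scat: "scattered (qpoly c)"
  shows "linear_MRD_with_field_nucleus \<iota> \<beta> 5 (qpoly c) \<and>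
    \<not> equivalent_codes (matrix_code \<iota> \<beta> (\<lambda>x. frob 1 x + frob 3 x + \<iota> b * frob 5 x))
        (matrix_code \<iota> \<beta> (qpoly c))"
proof
  show "linear_MRD_with_field_nucleus \<iota> \<beta> 5 (qpoly c)"
    by (intro linear_MRD_if_scattered base_linear_qpoly scat stab)
  have lin: "base_linear (\<lambda>x. frob 1 x + frob 3 x + \<iota> b * frob 5 x)"
    by (simp add: base_linear_def frob_add frob_mult algebra_simps)
  show "\<not> equivalent_codes (matrix_code \<iota> \<beta> (\<lambda>x. frob 1 x + frob 3 x + \<iota> b * frob 5 x))
        (matrix_code \<iota> \<beta> (qpoly c))"
    unfolding equivalent_codes_def
    using not_equivalent_direct[OF b refl lin c support stab]
      not_equivalent_transposed[OF b frob_\<iota> refl lin base_linear_qpoly]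
    by meson
qed

end

theorem theorem6p1:
  fixes \<iota> :: "'k::{field,finite} \<Rightarrow> 'l::{field,finite}"
    and \<beta> :: "6 \<Rightarrow> 'l"
    and q :: nat
    and b :: 'k
    and g :: "'l \<Rightarrow> 'l"
  assumes "CARD('k) = q" and "CARD('l) = q ^ 6"
    and "field_hom \<iota>" and "is_basis \<iota> \<beta>"
    and "odd q" and "q mod 5 \<in> {0, 1, 4}"
    and "b\<^sup>2 + b = 1"
    and "g = (\<lambda>x. x ^ q + x ^ (q ^ 3) + \<iota> b * x ^ (q ^ 5))"
  shows "linear_MRD_with_field_nucleus \<iota> \<beta> 5 g \<and>
    (\<forall>f \<in> {\<lambda>x. x ^ (q ^ s) | s. gcd s 6 = 1}
        \<union> {\<lambda>x. \<delta> * x ^ (q ^ s) + x ^ (q ^ (6 - s)) | \<delta> s.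
             s < 6 \<and> gcd s 6 = 1 \<and> \<delta> ^ (\<Sum>i<6. q ^ i) \<notin> {0, 1}}
        \<union> {f. \<exists>\<delta> s. f = (\<lambda>x. \<delta> * x ^ (q ^ s) + x ^ (q ^ (s + 3))) \<and>
             gcd s 3 = 1 \<and> \<delta> ^ (1 + q ^ 3) \<notin> {0, 1} \<and>
             maximum_scattered \<iota> {(x, f x) | x. True}}.
      linear_MRD_with_field_nucleus \<iota> \<beta> 5 f \<and>
      \<not> equivalent_codes (matrix_code \<iota> \<beta> g) (matrix_code \<iota> \<beta> f))"
proof -
  interpret sextic_extension_basis \<iota> q \<beta>
    by unfold_locales (use assms in auto)
  have b: "(\<iota> b)\<^sup>2 + \<iota> b = 1"
    using arg_cong[OF \<open>b\<^sup>2 + b = 1\<close>, of \<iota>] by (simp add: \<iota>_simps)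
  have g: "g = (\<lambda>x. frob 1 x + frob 3 x + \<iota> b * frob 5 x)"
    by (simp add: assms(8) frob_def)
  define cg where "cg i = (if i = 1 \<or> i = 3 then 1 else if i = 5 then \<iota> b else 0)" for i :: nat
  have g_qpoly: "g = qpoly cg"
    by (simp add: g fun_eq_iff qpoly_explicit cg_def)
  have mod_6: "s mod 6 = 1 \<or> s mod 6 = 5" if "gcd s 6 = 1" for s :: nat
  proof -
    have "\<not> 2 dvd s" "\<not> 3 dvd s"
      using that gcd_greatest[of 2 s 6] gcd_greatest[of 3 s 6] by auto
    then show ?thesis
      by presburger
  qed
  have mod_6': "s mod 6 = 1 \<or> s mod 6 = 2 \<or> s mod 6 = 4 \<or> s mod 6 = 5" if "gcd s 3 = 1" for s :: nat
  proof -
    have "\<not> 3 dvd s"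
      using that gcd_greatest[of 3 s 3] by auto
    then show ?thesis
      by presburger
  qed
  have "left_stabiliser_scalar g"
    unfolding g_qpoly by (rule left_stabiliser_scalar_two_terms[of _ 1 3]) (simp_all add: cg_def)
  moreover have "scattered g"
    unfolding g by (rule scattered_trinomial[OF b frob_\<iota> two_neq_0[OF assms(5)]])
  ultimately have code_g: "linear_MRD_with_field_nucleus \<iota> \<beta> 5 g"
    using linear_MRD_if_scattered base_linear_qpoly g_qpoly by metis
  have monomial: "linear_MRD_with_field_nucleus \<iota> \<beta> 5 f \<and>
      \<not> equivalent_codes (matrix_code \<iota> \<beta> g) (matrix_code \<iota> \<beta> f)"
    if "f = (\<lambda>x. x ^ (q ^ s))" "gcd s 6 = 1" for f s
  proof -
    define c :: "nat \<Rightarrow> 'l" where "c i = (if i = s mod 6 then 1 else 0)" for i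
    have f: "f = frob (s mod 6)"
      unfolding that(1) fun_eq_iff frob_mod_6 by (simp add: frob_def)
    then have "f = qpoly c"
      using mod_6[OF that(2)] by (auto simp: fun_eq_iff qpoly_explicit c_def)
    moreover have "scattered f"
      using mod_6[OF that(2)] scattered_frob_1 scattered_frob_5 f by auto
    moreover have "left_stabiliser_scalar f"
      unfolding f by (rule left_stabiliser_scalar_frob[OF mod_6[OF that(2)]])
    ultimately show ?thesis
      unfolding g using qpoly_code_properties[OF b, of c] mod_6[OF that(2)] by (auto simp: c_def)
  qed
  have inverse_exponents: "linear_MRD_with_field_nucleus \<iota> \<beta> 5 f \<and>
      \<not> equivalent_codes (matrix_code \<iota> \<beta> g) (matrix_code \<iota> \<beta> f)"
    if f: "f = (\<lambda>x. \<delta> * x ^ (q ^ s) + x ^ (q ^ (6 - s)))" and s: "s < 6" "gcd s 6 = 1"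
      and norm: "\<delta> ^ (\<Sum>i<6. q ^ i) \<notin> {0, 1}" for f \<delta> s
  proof -
    define c :: "nat \<Rightarrow> 'l" where "c i = (if i = s then \<delta> else if i = 6 - s then 1 else 0)" for i
    have s15: "s = 1 \<or> s = 5"
      using mod_6[OF s(2)] s(1) by simp
    have f': "f = (\<lambda>x. \<delta> * frob s x + frob (6 - s) x)"
      by (simp add: f frob_def)
    have fc: "f = qpoly c"
      using s15 by (auto simp: f' fun_eq_iff qpoly_explicit c_def simp flip: One_nat_def)
    have "\<delta> \<noteq> 0"
      using norm by (auto simp: sum_lessThan_6)
    then have "left_stabiliser_scalar (qpoly c)"
      using s15 by (intro left_stabiliser_scalar_two_terms[of _ 1 5]) (auto simp: c_def)
    moreover have "scattered f"
      unfolding f' using s15 scattered_frob_1 scattered_frob_5 norm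
      by (intro scattered_binomial_inverse) (auto simp: frob_frob simp flip: One_nat_def)
    ultimately show ?thesis
      unfolding g fc using s15 by (intro qpoly_code_properties[OF b]) (auto simp: c_def)
  qed
  have shifted_exponents: "linear_MRD_with_field_nucleus \<iota> \<beta> 5 f \<and>
      \<not> equivalent_codes (matrix_code \<iota> \<beta> g) (matrix_code \<iota> \<beta> f)"
    if f: "f = (\<lambda>x. \<delta> * x ^ (q ^ s) + x ^ (q ^ (s + 3)))" and s: "gcd s 3 = 1"
      and norm: "\<delta> ^ (1 + q ^ 3) \<notin> {0, 1}" and max: "maximum_scattered \<iota> {(x, f x) | x. True}" for f \<delta> s
  proof -
    define t where "t = s mod 6"
    define t' where "t' = (s + 3) mod 6"
    define c :: "nat \<Rightarrow> 'l" where "c i = (if i = t then \<delta> else if i = t' then 1 else 0)" for i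
    \<comment> \<open>The index pairs are {1, 4} and {2, 5} in either order, matching the last two
      alternatives of \<open>support\<close>.\<close>
    have t: "t = 1 \<and> t' = 4 \<or> t = 2 \<and> t' = 5 \<or> t = 4 \<and> t' = 1 \<or> t = 5 \<and> t' = 2"
      using mod_6'[OF s] unfolding t_def t'_def by presburger
    have f': "f = (\<lambda>x. \<delta> * frob t x + frob t' x)"
      unfolding t_def t'_def frob_mod_6 by (simp add: f frob_def)
    have fc: "f = qpoly c"
      using t by (auto simp: f' fun_eq_iff qpoly_explicit c_def)
    have "\<delta> \<noteq> 0"
      using norm by auto
    moreover have "left_stabiliser_scalar (qpoly c)"
      using t \<open>\<delta> \<noteq> 0\<close> by (intro left_stabiliser_scalar_two_terms[of _ t t']) (auto simp: c_def)
    moreover have "scattered (qpoly c)"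
      using scattered_if_maximum_scattered[OF base_linear_qpoly] max fc by metis
    ultimately show ?thesis
      unfolding g fc using t by (intro qpoly_code_properties[OF b]) (auto simp: c_def)
  qed
  show ?thesis
    by (rule conjI[OF code_g], rule ballI, elim UnE CollectE exE conjE)
      (rule monomial inverse_exponents shifted_exponents; assumption)+
qed

end
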